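(* Let $\mathcal{C}$ be an idempotent Mal'cev clone on $\{0,1,2\}$ such that $\mathcal{C}$ contains no majority operation and does not preserve $\varphi=\{(0,1),(1,2),(2,0)\}$. Then $\mathcal{C}\equiv_{\mathrm{m}}\mathcal{Z}_2$.
   Context: A clone is idempotent if $f(x,\dots,x)\approx x$ for all its operations; Mal'cev if it contains $d$ with $d(y,x,x)\approx d(x,x,y)\approx y$; a majority operation $m$ satisfies $m(x,y,y)\approx m(y,x,y)\approx m(y,y,x)\approx y$. $\mathcal{Z}_2=\mathrm{Pol}(\{0,1\};\{(x,y,z,x-y+z\bmod 2)\},\{0\},\{1\})$ is the clone of idempotent affine operations modulo 2, where $\mathrm{Pol}(\Gamma)$ denotes the clone of operations preserving all relations of $\Gamma$. For an $n$-ary $f$ and $\sigma\colon[n]\to[r]$, $f_\sigma(x_1,\dots,x_r)=f(x_{\sigma(1)},\dots,x_{\sigma(n)})$; a minion homomorphism is an arity-preserving map $\xi$ between clones with $\xi(f_\sigma)=\xi(f)_\sigma$; $\mathcal{C}\equiv_{\mathrm{m}}\mathcal{D}$ means there are minion homomorphisms in both directions. *)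

theory Defs
  imports "HOL-Library.FuncSet"
begin

text \<open>Operations on a carrier A (a set of naturals) are represented as pairs (n, f)
  with arity n >= 1 and f an extensional function from n-tuples (lists of length n
  over A) to A.  A clone is a set of such pairs.\<close>

definition tuples :: "nat set \<Rightarrow> nat \<Rightarrow> nat list set" where
  "tuples A n = {xs. length xs = n \<and> set xs \<subseteq> A}"

definition ops :: "nat set \<Rightarrow> nat \<Rightarrow> (nat list \<Rightarrow> nat) set" where
  "ops A n = (tuples A n \<rightarrow>\<^sub>E A)"

definition proj :: "nat set \<Rightarrow> nat \<Rightarrow> nat \<Rightarrow> (nat list \<Rightarrow> nat)" where
  "proj A n i = restrict (\<lambda>xs. xs ! i) (tuples A n)"

definition compose :: "nat set \<Rightarrow> nat \<Rightarrow> (nat list \<Rightarrow> nat) \<Rightarrow> (nat list \<Rightarrow> nat) list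
    \<Rightarrow> (nat list \<Rightarrow> nat)" where
  "compose A m f gs = restrict (\<lambda>xs. f (map (\<lambda>g. g xs) gs)) (tuples A m)"

definition is_clone :: "nat set \<Rightarrow> (nat \<times> (nat list \<Rightarrow> nat)) set \<Rightarrow> bool" where
  "is_clone A C \<longleftrightarrow>
     (\<forall>(n, f) \<in> C. n \<ge> 1 \<and> f \<in> ops A n) \<and>
     (\<forall>n i. 1 \<le> n \<and> i < n \<longrightarrow> (n, proj A n i) \<in> C) \<and>
     (\<forall>n m f gs. (n, f) \<in> C \<and> m \<ge> 1 \<and> length gs = n \<and> (\<forall>g \<in> set gs. (m, g) \<in> C)
        \<longrightarrow> (m, compose A m f gs) \<in> C)"

definition minor :: "nat set \<Rightarrow> nat \<Rightarrow> nat \<Rightarrow> (nat \<Rightarrow> nat) \<Rightarrow> (nat list \<Rightarrow> nat)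
    \<Rightarrow> (nat list \<Rightarrow> nat)" where
  "minor A n r \<sigma> f = restrict (\<lambda>xs. f (map (\<lambda>i. xs ! \<sigma> i) [0..<n])) (tuples A r)"

definition minion_hom :: "nat set \<Rightarrow> (nat \<times> (nat list \<Rightarrow> nat)) set \<Rightarrow> nat set
    \<Rightarrow> (nat \<times> (nat list \<Rightarrow> nat)) set \<Rightarrow> (nat \<Rightarrow> (nat list \<Rightarrow> nat) \<Rightarrow> (nat list \<Rightarrow> nat)) \<Rightarrow> bool" where
  "minion_hom A C B D \<xi> \<longleftrightarrow>
     (\<forall>(n, f) \<in> C. (n, \<xi> n f) \<in> D) \<and>
     (\<forall>(n, f) \<in> C. \<forall>r \<sigma>. r \<ge> 1 \<and> (\<forall>i < n. \<sigma> i < r)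
        \<longrightarrow> \<xi> r (minor A n r \<sigma> f) = minor B n r \<sigma> (\<xi> n f))"

definition minion_equiv :: "nat set \<Rightarrow> (nat \<times> (nat list \<Rightarrow> nat)) set \<Rightarrow> nat set
    \<Rightarrow> (nat \<times> (nat list \<Rightarrow> nat)) set \<Rightarrow> bool" where
  "minion_equiv A C B D \<longleftrightarrow> (\<exists>\<xi>. minion_hom A C B D \<xi>) \<and> (\<exists>\<zeta>. minion_hom B D A C \<zeta>)"

definition idempotent_clone :: "nat set \<Rightarrow> (nat \<times> (nat list \<Rightarrow> nat)) set \<Rightarrow> bool" where
  "idempotent_clone A C \<longleftrightarrow> (\<forall>(n, f) \<in> C. \<forall>a \<in> A. f (replicate n a) = a)"

definition malcev_clone :: "nat set \<Rightarrow> (nat \<times> (nat list \<Rightarrow> nat)) set \<Rightarrow> bool" where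
  "malcev_clone A C \<longleftrightarrow> (\<exists>d. (3, d) \<in> C \<and>
     (\<forall>x \<in> A. \<forall>y \<in> A. d [y, x, x] = y \<and> d [x, x, y] = y))"

definition has_majority :: "nat set \<Rightarrow> (nat \<times> (nat list \<Rightarrow> nat)) set \<Rightarrow> bool" where
  "has_majority A C \<longleftrightarrow> (\<exists>m. (3, m) \<in> C \<and>
     (\<forall>x \<in> A. \<forall>y \<in> A. m [x, y, y] = y \<and> m [y, x, y] = y \<and> m [y, y, x] = y))"

definition preserves :: "nat \<Rightarrow> (nat list \<Rightarrow> nat) \<Rightarrow> nat \<Rightarrow> nat list set \<Rightarrow> bool" where
  "preserves n f k R \<longleftrightarrow>
     (\<forall>rs. length rs = n \<and> set rs \<subseteq> R \<longrightarrow> map (\<lambda>j. f (map (\<lambda>t. t ! j) rs)) [0..<k] \<in> R)"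

definition Pol :: "nat set \<Rightarrow> (nat \<times> nat list set) set \<Rightarrow> (nat \<times> (nat list \<Rightarrow> nat)) set" where
  "Pol A \<Gamma> = {(n, f). n \<ge> 1 \<and> f \<in> ops A n \<and> (\<forall>(k, R) \<in> \<Gamma>. preserves n f k R)}"

definition clone_preserves :: "(nat \<times> (nat list \<Rightarrow> nat)) set \<Rightarrow> nat \<Rightarrow> nat list set \<Rightarrow> bool" where
  "clone_preserves C k R \<longleftrightarrow> (\<forall>(n, f) \<in> C. preserves n f k R)"

definition affine2_rel :: "nat list set" where
  "affine2_rel = {[x, y, z, nat ((int x - int y + int z) mod 2)] | x y z. x \<in> {0,1} \<and> y \<in> {0,1} \<and> z \<in> {0,1}}"

definition Z2 :: "(nat \<times> (nat list \<Rightarrow> nat)) set" where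
  "Z2 = Pol {0, 1} {(4, affine2_rel), (1, {[0]}), (1, {[1]})}"

definition phi :: "nat list set" where
  "phi = {[0, 1], [1, 2], [2, 0]}"

end

theory Submission
  imports Defs
begin

text \<open>
  Let \<open>s\<^sub>c\<close> be the symmetric minority operation with value \<open>c\<close> on the permutations of \<open>(0, 1, 2)\<close>.
  The clone contains \<open>s\<^sub>c\<close> for some \<open>c\<close>: a Mal'cev operation can be turned into a minority
  operation unless it is \<open>x - y + z\<close> modulo 3, and a minority operation can be symmetrized unless it
  commutes with the cycle \<open>x \<mapsto> x + 1\<close>; both obstructions disappear when an operation that does not
  preserve \<open>\<phi>\<close> is composed in.

  From \<open>s\<^sub>c\<close> one obtains, for every odd \<open>n\<close>, the symmetric \<open>n\<close>-ary operation that cancels equal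
  arguments in pairs and then takes the remaining element, or \<open>c\<close> if all three elements remain. These
  operations are the image of a minion homomorphism from \<open>Z2\<close>.

  Conversely, the absence of a majority operation yields an invariant ternary relation containing
  \<open>(a\<^sub>1, t\<^sub>2, t\<^sub>3)\<close>, \<open>(t\<^sub>1, a\<^sub>2, t\<^sub>3)\<close>, \<open>(t\<^sub>1, t\<^sub>2, a\<^sub>3)\<close> but not \<open>(t\<^sub>1, t\<^sub>2, t\<^sub>3)\<close>. Invariance under \<open>s\<^sub>c\<close>
  forces it to be an affine equation modulo 2, so that reading the operations of the clone through
  \<open>t\<^sub>1\<close> and \<open>a\<^sub>1\<close> gives affine operations modulo 2.
\<close>

subsection \<open>Idempotent clones on three elements\<close>

lemma tuples_nth: "xs \<in> tuples A n \<Longrightarrow> i < n \<Longrightarrow> xs ! i \<in> A"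
  by (auto simp: tuples_def)

lemma tuplesI: "length xs = n \<Longrightarrow> (\<And>i. i < n \<Longrightarrow> xs ! i \<in> A) \<Longrightarrow> xs \<in> tuples A n"
  by (auto simp: tuples_def in_set_conv_nth)

lemma tuples_3: "xs \<in> tuples A 3 \<longleftrightarrow> (\<exists>x\<in>A. \<exists>y\<in>A. \<exists>z\<in>A. xs = [x, y, z])"
  by (auto simp: tuples_def numeral_3_eq_3 length_Suc_conv)

definition three :: "nat set" where
  "three = {0, 1, 2}"

definition sym_minority :: "nat \<Rightarrow> nat \<Rightarrow> nat \<Rightarrow> nat \<Rightarrow> nat" where
  "sym_minority c x y z = (if y = z then x else if x = y then z else if x = z then y else c)"

locale idempotent_clone_on_three =
  fixes C :: "(nat \<times> (nat list \<Rightarrow> nat)) set"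
  assumes clone: "is_clone three C"
    and idempotent: "idempotent_clone three C"
begin

abbreviation "A \<equiv> three"

text \<open>Operations of the clone are extensional; this predicate allows arbitrary representatives,
  so that term operations can be written as plain lambda abstractions.\<close>

definition admits :: "nat \<Rightarrow> (nat list \<Rightarrow> nat) \<Rightarrow> bool" where
  "admits n f \<longleftrightarrow> (n, restrict f (tuples A n)) \<in> C"

lemma admits_cong: "admits n f \<Longrightarrow> (\<And>xs. xs \<in> tuples A n \<Longrightarrow> f xs = g xs) \<Longrightarrow> admits n g"
  unfolding admits_def by (metis restrict_ext)

lemma mem_ops: "(n, f) \<in> C \<Longrightarrow> 1 \<le> n \<and> f \<in> ops A n"
  using clone unfolding is_clone_def by auto

lemma admits_pos: "admits n f \<Longrightarrow> 1 \<le> n"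
  unfolding admits_def using mem_ops by blast

lemma admits_closed:
  assumes "admits n f" "xs \<in> tuples A n"
  shows "f xs \<in> A"
  using mem_ops[OF assms(1)[unfolded admits_def]] assms(2) unfolding ops_def
  by (metis PiE_mem restrict_apply')

lemma admits_mem: "(n, f) \<in> C \<Longrightarrow> admits n f"
  using mem_ops[of n f] unfolding admits_def ops_def by (metis PiE_restrict)

lemma admits_proj: "i < n \<Longrightarrow> admits n (\<lambda>xs. xs ! i)"
  using clone unfolding admits_def is_clone_def proj_def by auto

lemma admits_compose:
  assumes f: "admits k f" and n: "1 \<le> n"
    and len: "length gs = k" and gs: "\<And>g. g \<in> set gs \<Longrightarrow> admits n g"
  shows "admits n (\<lambda>xs. f (map (\<lambda>g. g xs) gs))"
proof -
  let ?gs = "map (\<lambda>g. restrict g (tuples A n)) gs"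
  have "(n, compose A n (restrict f (tuples A k)) ?gs) \<in> C"
    using clone f n len gs unfolding is_clone_def admits_def by force
  moreover have "compose A n (restrict f (tuples A k)) ?gs
      = restrict (\<lambda>xs. f (map (\<lambda>g. g xs) gs)) (tuples A n)"
  proof (unfold compose_def, rule restrict_ext)
    fix xs assume xs: "xs \<in> tuples A n"
    then have "map (\<lambda>g. g xs) ?gs = map (\<lambda>g. g xs) gs" by simp
    moreover have "map (\<lambda>g. g xs) gs \<in> tuples A k"
      using len admits_closed[OF gs xs] unfolding tuples_def by auto
    ultimately show "restrict f (tuples A k) (map (\<lambda>g. g xs) ?gs) = f (map (\<lambda>g. g xs) gs)"
      by (metis restrict_apply')
  qed
  ultimately show ?thesis unfolding admits_def by simp
qed

lemma admits_idempotent: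
  assumes "admits n f" "a \<in> A"
  shows "f (replicate n a) = a"
proof -
  have "replicate n a \<in> tuples A n" using assms(2) by (auto simp: tuples_def)
  then show ?thesis
    using idempotent assms unfolding admits_def idempotent_clone_def by (metis (mono_tags, lifting) case_prodD restrict_apply')
qed

definition ternary :: "(nat \<Rightarrow> nat \<Rightarrow> nat \<Rightarrow> nat) \<Rightarrow> bool" where
  "ternary f \<longleftrightarrow> admits 3 (\<lambda>xs. f (xs ! 0) (xs ! 1) (xs ! 2))"

lemma ternary_proj:
  "ternary (\<lambda>x y z. x)" "ternary (\<lambda>x y z. y)" "ternary (\<lambda>x y z. z)"
  unfolding ternary_def by (rule admits_proj; simp)+

lemma ternary_apply:
  assumes "ternary f" "admits n g" "admits n h" "admits n k"
  shows "admits n (\<lambda>xs. f (g xs) (h xs) (k xs))"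
  using admits_compose[OF assms(1)[unfolded ternary_def] admits_pos[OF assms(2)], of "[g, h, k]"] assms
  by auto

lemma ternary_compose:
  assumes "ternary f" "ternary g" "ternary h" "ternary k"
  shows "ternary (\<lambda>x y z. f (g x y z) (h x y z) (k x y z))"
  using ternary_apply[of f 3] assms unfolding ternary_def by simp

lemma ternary_cong:
  assumes "ternary f" "\<And>x y z. x \<in> A \<Longrightarrow> y \<in> A \<Longrightarrow> z \<in> A \<Longrightarrow> f x y z = g x y z"
  shows "ternary g"
  using assms(1) unfolding ternary_def
  by (rule admits_cong) (auto simp: assms(2) tuples_3)

lemma ternary_closed: "ternary f \<Longrightarrow> x \<in> A \<Longrightarrow> y \<in> A \<Longrightarrow> z \<in> A \<Longrightarrow> f x y z \<in> A"
  unfolding ternary_def using admits_closed[of 3 "\<lambda>xs. f (xs ! 0) (xs ! 1) (xs ! 2)" "[x, y, z]"]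
  by (auto simp: tuples_3)

lemma ternary_idempotent: "ternary f \<Longrightarrow> x \<in> A \<Longrightarrow> f x x x = x"
  unfolding ternary_def using admits_idempotent[of 3 "\<lambda>xs. f (xs ! 0) (xs ! 1) (xs ! 2)" x]
  by (simp add: numeral_3_eq_3 numeral_2_eq_2)

subsection \<open>From a Mal'cev operation to a minority operation\<close>

definition malcev_op :: "(nat \<Rightarrow> nat \<Rightarrow> nat \<Rightarrow> nat) \<Rightarrow> bool" where
  "malcev_op d \<longleftrightarrow> ternary d \<and> (\<forall>x\<in>A. \<forall>y\<in>A. d y x x = y \<and> d x x y = y)"

text \<open>If \<^term>\<open>x\<close> and \<^term>\<open>y\<close> are distinct elements of \<^const>\<open>three\<close>, then \<^term>\<open>3 - x - y :: nat\<close>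
  is the third one. Swapping at every point is what the affine operation \<open>x - y + z\<close> modulo 3 does.\<close>

definition swaps_at :: "(nat \<Rightarrow> nat \<Rightarrow> nat \<Rightarrow> nat) \<Rightarrow> nat \<Rightarrow> bool" where
  "swaps_at d x \<longleftrightarrow> (\<forall>y\<in>A - {x}. d x y x = 3 - x - y)"

text \<open>On a two-element set, the first term below turns every Mal'cev operation into the minority
  operation. The second one removes swaps: if \<open>e y x y = x\<close>, then it takes the value \<open>y\<close> at \<open>(x, y, x)\<close>.\<close>

definition improve :: "(nat \<Rightarrow> nat \<Rightarrow> nat \<Rightarrow> nat) \<Rightarrow> nat \<Rightarrow> nat \<Rightarrow> nat \<Rightarrow> nat" where
  "improve d x y z = d (d x y z) (d x (d x y z) z) y"

definition twist :: "(nat \<Rightarrow> nat \<Rightarrow> nat \<Rightarrow> nat) \<Rightarrow> nat \<Rightarrow> nat \<Rightarrow> nat \<Rightarrow> nat" where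
  "twist d x y z = d x (d y x y) (d y x z)"

lemma malcev_improve:
  assumes "malcev_op d" shows "malcev_op (improve d)"
proof -
  have "ternary d" using assms malcev_op_def by blast
  note c = ternary_compose[OF this]
  have "ternary (improve d)" unfolding improve_def by (intro c ternary_proj)
  then show ?thesis using assms unfolding malcev_op_def improve_def by auto
qed

lemma malcev_twist:
  assumes "malcev_op d" shows "malcev_op (twist d)"
proof -
  have d: "ternary d" using assms malcev_op_def by blast
  note c = ternary_compose[OF this]
  have "ternary (twist d)" unfolding twist_def by (intro c ternary_proj)
  then show ?thesis using assms ternary_closed[OF d] unfolding malcev_op_def twist_def by auto
qed

text \<open>Improving corrects \<open>e x y x\<close> if it lies in {x, y} or is a fixed point of
  \<open>\<lambda>u. e x u x\<close>. As \<open>d\<close> does not swap everywhere at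
  \<open>x\<close>, some \<open>z\<close> is corrected in the first round; \<open>z\<close> is then
  such a fixed point, which settles the remaining element in the second round.\<close>

lemma improve_improve:
  assumes d: "malcev_op d" and x: "x \<in> A" and n: "\<not> swaps_at d x" and y: "y \<in> A"
  shows "improve (improve d) x y x = y"
proof -
  have good: "improve e x y x = y"
    if e: "malcev_op e" and y: "y \<in> A"
      and "e x y x = y \<or> e x y x = x \<or> e x (e x y x) x = e x y x" for e y
  proof -
    have "e x y x \<in> A" using e ternary_closed x y unfolding malcev_op_def by blast
    then show ?thesis using that x unfolding improve_def malcev_op_def by metis
  qed
  obtain z where z: "z \<in> A" "z \<noteq> x" "d x z x \<noteq> 3 - x - z"
    using n unfolding swaps_at_def by blast
  define w where "w = 3 - x - z"
  have A: "A = {x, z, w}" using x z(1,2) unfolding w_def three_def by auto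
  have closed: "e x y x \<in> {x, z, w}" if "malcev_op e" "y \<in> A" for e y
    using that x ternary_closed unfolding malcev_op_def A[symmetric] by blast
  have 1: "improve d x z x = z"
    using good[OF d z(1)] closed[OF d z(1)] z(3) unfolding w_def[symmetric] by blast
  note d' = malcev_improve[OF d]
  have "improve d x y x = y \<or> improve d x y x = x \<or>
      improve d x (improve d x y x) x = improve d x y x"
    using closed[OF d' y] 1 y unfolding A by (metis empty_iff insert_iff malcev_op_def ternary_idempotent d' x)
  then show ?thesis using good[OF d' y] by blast
qed

lemma twist_not_swaps_at:
  assumes e: "malcev_op e" and y: "y \<in> A" "e y x y = x" and x: "x \<in> A" "x \<noteq> y"
  shows "\<not> swaps_at (twist e) x"
proof
  assume "swaps_at (twist e) x"
  then have "twist e x y x = 3 - x - y" using x y unfolding swaps_at_def by blast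
  moreover have "twist e x y x = y" using e x y unfolding twist_def malcev_op_def by simp
  ultimately show False using x y by (auto simp: three_def)
qed

definition is_minority :: "(nat \<Rightarrow> nat \<Rightarrow> nat \<Rightarrow> nat) \<Rightarrow> bool" where
  "is_minority m \<longleftrightarrow> malcev_op m \<and> (\<forall>x\<in>A. \<forall>y\<in>A. m x y x = y)"

text \<open>Repairing at \<open>x\<close> and twisting stops the swapping at both other points;
  repairing and twisting again stops it everywhere, since each point differs from one of those
  two.\<close>

lemma minority_if_not_swaps_at:
  assumes d: "malcev_op d" and x: "x \<in> A" "\<not> swaps_at d x"
  shows "\<exists>m. is_minority m"
proof -
  define e where "e = improve (improve d)"
  define d1 where "d1 = twist e"
  define e1 where "e1 = improve (improve d1)"
  define d2 where "d2 = twist e1"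
  have e: "malcev_op e" unfolding e_def by (intro malcev_improve d)
  then have d1: "malcev_op d1" unfolding d1_def by (rule malcev_twist)
  then have e1: "malcev_op e1" unfolding e1_def by (intro malcev_improve)
  then have d2: "malcev_op d2" unfolding d2_def by (rule malcev_twist)
  have "e x y x = y" if "y \<in> A" for y
    unfolding e_def using improve_improve[OF d x that] .
  then have "\<not> swaps_at d1 y" if "y \<in> A" "y \<noteq> x" for y
    unfolding d1_def using twist_not_swaps_at[OF e x(1) _ that] that(1) by blast
  then have good1: "e1 y z y = z" if "y \<in> A" "y \<noteq> x" "z \<in> A" for y z
    unfolding e1_def using improve_improve[OF d1 that(1)] that by blast
  have "\<not> swaps_at d2 z" if "z \<in> A" for z
  proof -
    obtain y where y: "y \<in> A" "y \<noteq> x" "z \<noteq> y"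
    proof (cases "x = z")
      case True
      have "(if x = 0 then 1 else 0) \<in> A" "(if x = 0 then 1 else 0) \<noteq> x" by (auto simp: three_def)
      then show ?thesis using that True by metis
    next
      case False
      have "3 - x - z \<in> A" "3 - x - z \<noteq> x" "3 - x - z \<noteq> z" using x(1) \<open>z \<in> A\<close> False by (auto simp: three_def)
      then show ?thesis using that by metis
    qed
    then show ?thesis unfolding d2_def using twist_not_swaps_at[OF e1 y(1) good1 that] that by blast
  qed
  then have "improve (improve d2) y z y = z" if "y \<in> A" "z \<in> A" for y z
    using improve_improve[OF d2] that by blast
  then have "is_minority (improve (improve d2))"
    unfolding is_minority_def using malcev_improve[OF malcev_improve[OF d2]] by blast
  then show ?thesis by blast
qed

section \<open>Operations that swap at every point, and the affine operation modulo 3\<close>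

definition is_affine3 :: "(nat \<Rightarrow> nat \<Rightarrow> nat \<Rightarrow> nat) \<Rightarrow> bool" where
  "is_affine3 d \<longleftrightarrow> (\<forall>x\<in>A. \<forall>y\<in>A. \<forall>z\<in>A. d x y z = (x + 2 * y + z) mod 3)"

text \<open>Without a minority operation, \<open>d\<close> and \<open>twist d\<close> both swap at
  every point. The first determines \<open>d\<close> at \<open>(x, y, x)\<close>, the second at the
  permutations of (0, 1, 2); the values are those of x - y + z modulo 3.\<close>

lemma minority_if_not_affine3:
  assumes d: "malcev_op d" and n: "\<not> is_affine3 d"
  shows "\<exists>m. is_minority m"
proof (rule ccontr)
  assume no: "\<not> ?thesis"
  have s: "swaps_at d x" "swaps_at (twist d) x" if "x \<in> A" for x
    using minority_if_not_swaps_at[OF _ that] no d malcev_twist[OF d] by blast+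
  have m: "d x y x = 3 - x - y" "d x (3 - x - y) y = 3 - x - y" if "x \<in> A" "y \<in> A" "x \<noteq> y" for x y
  proof -
    show *: "d x y x = 3 - x - y" using s(1)[OF that(1)] that unfolding swaps_at_def by blast
    have "d y x y = 3 - x - y" using s(1)[OF that(2)] that unfolding swaps_at_def by (metis DiffI diff_commute singletonD)
    moreover have "twist d x y x = 3 - x - y" using s(2)[OF that(1)] that unfolding swaps_at_def by blast
    ultimately show "d x (3 - x - y) y = 3 - x - y"
      using d that unfolding twist_def malcev_op_def by auto
  qed
  have "is_affine3 d"
    using d m(1)[of 0 1] m(1)[of 0 2] m(1)[of 1 0] m(1)[of 1 2] m(1)[of 2 0] m(1)[of 2 1]
      m(2)[of 0 1] m(2)[of 0 2] m(2)[of 1 0] m(2)[of 1 2] m(2)[of 2 0] m(2)[of 2 1]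
    unfolding is_affine3_def malcev_op_def three_def by simp
  then show False using n by blast
qed

lemma not_affine3_if_not_shift_invariant:
  assumes d: "malcev_op d" and g: "ternary g" "g 1 2 0 \<noteq> (g 0 1 2 + 1) mod 3"
  shows "\<exists>e. malcev_op e \<and> \<not> is_affine3 e"
proof (rule ccontr)
  assume no: "\<not> ?thesis"
  have aff: "is_affine3 e" if "malcev_op e" for e using no that by blast
  have td: "ternary d" using d unfolding malcev_op_def by blast
  note dc = ternary_compose[OF td]
  have arith: "c mod 3 = (a + 1) mod 3"
    if "(a + 2 + b) mod 3 = 1" "(c + b) mod 3 = 0" for a b c :: nat
    using that by presburger
  \<comment> \<open>For affine \<open>d\<close>, \<open>d x y x\<close> is the third element when
    \<open>x\<close> and \<open>y\<close> differ, so \<open>h 0 1 = g 0 1 2\<close> and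
    \<open>h 1 2 = g 1 2 0\<close>.\<close>
  define h where "h x y = g x y (d x y x)" for x y
  have h: "ternary (\<lambda>x y z. h (p x y z) (q x y z))" if "ternary p" "ternary q" for p q
    unfolding h_def by (intro ternary_compose[OF g(1)] dc that)
  have d_eq: "d x y z = (x + 2 * y + z) mod 3" if "x \<in> A" "y \<in> A" "z \<in> A" for x y z
    using aff[OF d] that unfolding is_affine3_def by blast
  have hA: "h x y \<in> A" if "x \<in> A" "y \<in> A" for x y
    using ternary_closed[OF h[OF ternary_proj(1,2)] that that(1)] .
  have hid: "h x x = x" if "x \<in> A" for x
    using ternary_idempotent[OF h[OF ternary_proj(1,2)] that] .
  \<comment> \<open>If \<open>x = y\<close> or \<open>y = z\<close>, the values of \<open>h\<close>
    at distinct arguments cancel modulo 3, so \<open>m\<close> is Mal'cev, hence affine; at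
    \<open>(x, y, x)\<close> this gives \<open>h_sym\<close>.\<close>
  define m where "m x y z = d (d (h x y) (h x z) (h y z)) y (d x y z)" for x y z
  have "ternary m" unfolding m_def by (intro dc h ternary_proj)
  have m_eq: "m x y z = (h x y + 2 * h x z + h y z + x + y + z) mod 3" if "x \<in> A" "y \<in> A" "z \<in> A" for x y z
  proof -
    have "m x y z = (d (h x y) (h x z) (h y z) + 2 * y + d x y z) mod 3"
      unfolding m_def by (rule d_eq) (simp_all add: that hA ternary_closed[OF td])
    also have "\<dots> = ((h x y + 2 * h x z + h y z) mod 3 + 2 * y + (x + 2 * y + z) mod 3) mod 3"
      using that hA d_eq by simp
    also have "\<dots> = (h x y + 2 * h x z + h y z + 2 * y + (x + 2 * y + z)) mod 3"
      by (simp only: mod_add_right_eq) (metis add.assoc mod_add_left_eq)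
    also have "h x y + 2 * h x z + h y z + 2 * y + (x + 2 * y + z)
        = h x y + 2 * h x z + h y z + x + y + z + 3 * y" by simp
    also have "\<dots> mod 3 = (h x y + 2 * h x z + h y z + x + y + z) mod 3" by (rule mod_mult_self2)
    finally show ?thesis .
  qed
  have "m x x z = z" "m x z z = x" if "x \<in> A" "z \<in> A" for x z
  proof -
    have "m x x z = (3 * (h x z + x) + z) mod 3" "m x z z = (3 * (h x z + z) + x) mod 3"
      using m_eq that hid by (simp_all add: algebra_simps)
    then have "m x x z = z mod 3" "m x z z = x mod 3" by (simp_all only: mod_mult_self4)
    then show "m x x z = z" "m x z z = x" using that unfolding three_def by auto
  qed
  with \<open>ternary m\<close> have "is_affine3 m" by (intro aff) (simp add: malcev_op_def)
  have h_sym: "(h x y + h y x) mod 3 = (x + y) mod 3" if "x \<in> A" "y \<in> A" for x y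
  proof -
    have "(h x y + 2 * x + h y x + x + y + x) mod 3 = (x + 2 * y + x) mod 3"
      using \<open>is_affine3 m\<close> that m_eq[of x y x] hid[of x] unfolding is_affine3_def by metis
    then have "(h x y + 2 * x + h y x + x + y + x + (2 * x + 2 * y)) mod 3
        = (x + 2 * y + x + (2 * x + 2 * y)) mod 3"
      by (metis mod_add_left_eq)
    moreover have "h x y + 2 * x + h y x + x + y + x + (2 * x + 2 * y)
        = h x y + h y x + 3 * (2 * x + y)"
      "x + 2 * y + x + (2 * x + 2 * y) = x + y + 3 * (x + y)" by simp_all
    ultimately show ?thesis by (simp only: mod_mult_self2)
  qed
  \<comment> \<open>Mal'cev because of \<open>h_sym\<close>. Its affine value at (0, 1, 2) links
    \<open>h 0 1\<close> to \<open>h 2 1\<close>, which \<open>h_sym\<close> links to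
    \<open>h 1 2\<close>.\<close>
  define n where "n x y z = d (h x (d x y z)) y (h z y)" for x y z
  have "ternary n" unfolding n_def by (intro dc h ternary_proj)
  have n_eq: "n x y z = (h x (d x y z) + 2 * y + h z y) mod 3" if "x \<in> A" "y \<in> A" "z \<in> A" for x y z
    unfolding n_def by (rule d_eq) (simp_all add: that hA ternary_closed[OF td])
  have "n x x z = z" "n x z z = x" if "x \<in> A" "z \<in> A" for x z
  proof -
    have "n x x z = (h x z + 2 * x + h z x) mod 3" "n x z z = (x + 2 * z + z) mod 3"
      using n_eq that hid d unfolding malcev_op_def by simp_all
    moreover have "(h x z + 2 * x + h z x) mod 3 = (x + z + 2 * x) mod 3"
      using h_sym[OF that] by (metis add.commute add.left_commute mod_add_left_eq)
    moreover have "x + z + 2 * x = 3 * x + z" "x + 2 * z + z = 3 * z + x" by simp_all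
    ultimately have "n x x z = z mod 3" "n x z z = x mod 3" by (simp_all only: mod_mult_self4)
    then show "n x x z = z" "n x z z = x" using that unfolding three_def by auto
  qed
  with \<open>ternary n\<close> have "is_affine3 n" by (intro aff) (simp add: malcev_op_def)
  then have "n 0 1 2 = 1" unfolding is_affine3_def three_def by simp
  moreover have "d 0 1 2 = 1" "d 0 1 0 = 2" "d 1 2 1 = 0" using d_eq unfolding three_def by simp_all
  ultimately have "(h 0 1 + 2 + h 2 1) mod 3 = 1" using n_eq[of 0 1 2] unfolding three_def by simp
  moreover have "(h 1 2 + h 2 1) mod 3 = 0" using h_sym[of 1 2] unfolding three_def by simp
  ultimately have "h 1 2 mod 3 = (h 0 1 + 1) mod 3"
    by (rule arith)
  moreover have "h 1 2 < 3" using hA[of 1 2] unfolding three_def by auto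
  ultimately have "h 1 2 = (h 0 1 + 1) mod 3" by simp
  with g(2) \<open>d 0 1 0 = 2\<close> \<open>d 1 2 1 = 0\<close> show False unfolding h_def by simp
qed

lemma minority_exists:
  assumes "malcev_op d" "ternary g" "g 1 2 0 \<noteq> (g 0 1 2 + 1) mod 3"
  shows "\<exists>m. is_minority m"
  using not_affine3_if_not_shift_invariant[OF assms] minority_if_not_affine3 by blast

end

subsection \<open>Symmetrizing a minority operation\<close>

definition minority_of :: "nat list \<Rightarrow> nat \<Rightarrow> nat \<Rightarrow> nat \<Rightarrow> nat" where
  "minority_of v x y z = (if y = z then x else if x = y then z else if x = z then y
     else if x = 0 then (if y = 1 then v ! 0 else v ! 3)
     else if x = 1 then (if y = 2 then v ! 1 else v ! 4)
     else (if y = 0 then v ! 2 else v ! 5))"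

text \<open>A minority operation is determined by its values at the six permutations of \<open>(0, 1, 2)\<close>,
  listed with the even permutations first.\<close>

definition rainbow_values :: "(nat \<Rightarrow> nat \<Rightarrow> nat \<Rightarrow> nat) \<Rightarrow> nat list" where
  "rainbow_values m = [m 0 1 2, m 1 2 0, m 2 0 1, m 0 2 1, m 1 0 2, m 2 1 0]"

text \<open>The halves of \<open>v\<close> belong to the even and the odd permutations. The last
  term makes a half constant unless its values are distinct; the middle one turns two different
  constants into the third element on both halves.\<close>

definition symmetrize :: "nat list \<Rightarrow> (nat \<Rightarrow> nat \<Rightarrow> nat \<Rightarrow> nat) \<Rightarrow> nat \<Rightarrow> nat \<Rightarrow> nat \<Rightarrow> nat" where
  "symmetrize v m =
    (if distinct (take 3 v) \<and> distinct (drop 3 v)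
     then (\<lambda>x y z. m (m x z (m z y x)) (m y x (m z y x)) (m z y (m z y x)))
     else if v ! 0 = v ! 1 \<and> v ! 1 = v ! 2 \<and> v ! 3 = v ! 4 \<and> v ! 4 = v ! 5
     then (\<lambda>x y z. m (m x z (m x y z)) (m y x (m x y z)) (m z y (m x y z)))
     else (\<lambda>x y z. m (m x y z) (m z x y) (m y z x)))"

definition symmetrized_values :: "nat list \<Rightarrow> nat list" where
  "symmetrized_values v = rainbow_values (symmetrize v (minority_of v))"

definition shift_invariant :: "nat list \<Rightarrow> bool" where
  "shift_invariant v \<longleftrightarrow> v ! 1 = Suc (v ! 0) mod 3 \<and> v ! 2 = Suc (v ! 1) mod 3 \<and>
     v ! 4 = Suc (v ! 3) mod 3 \<and> v ! 5 = Suc (v ! 4) mod 3"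

text \<open>The three terms in \<^const>\<open>symmetrize\<close> were found by a computer search over the 729 minority
  operations; only the 9 operations commuting with \<open>x \<mapsto> x + 1\<close> modulo 3 cannot be symmetrized.\<close>

lemma symmetrized_twice_constant_all:
  "list_all (\<lambda>v. shift_invariant v \<or>
     (let w = symmetrized_values (symmetrized_values v) in w = replicate 6 (hd w)))
   (List.n_lists 6 [0, 1, 2])"
  by code_simp

lemma symmetrized_twice_constant:
  assumes "length v = 6" "set v \<subseteq> three" "\<not> shift_invariant v"
  shows "\<exists>c. symmetrized_values (symmetrized_values v) = replicate 6 c"
proof -
  have "v \<in> set (List.n_lists 6 [0, 1, 2])"
    using assms(1,2) unfolding set_n_lists three_def by simp
  then show ?thesis
    using symmetrized_twice_constant_all assms(3) unfolding list_all_iff Let_def by blast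
qed

context idempotent_clone_on_three
begin

lemma is_minorityI:
  assumes "ternary m" "\<And>x y. x \<in> A \<Longrightarrow> y \<in> A \<Longrightarrow> m y x x = y \<and> m x x y = y \<and> m x y x = y"
  shows "is_minority m"
  using assms unfolding is_minority_def malcev_op_def by blast

lemma is_minorityD:
  assumes "is_minority m"
  shows "ternary m" "x \<in> A \<Longrightarrow> y \<in> A \<Longrightarrow> m y x x = y"
    "x \<in> A \<Longrightarrow> y \<in> A \<Longrightarrow> m x x y = y" "x \<in> A \<Longrightarrow> y \<in> A \<Longrightarrow> m x y x = y"
  using assms unfolding is_minority_def malcev_op_def by blast+

lemma is_minority_symmetrize:
  assumes "is_minority m" shows "is_minority (symmetrize v m)"
proof -
  note m = is_minorityD[OF assms]
  note mc = ternary_compose[OF m(1)]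
  have "is_minority (\<lambda>x y z. m (m x z (m z y x)) (m y x (m z y x)) (m z y (m z y x)))"
    "is_minority (\<lambda>x y z. m (m x z (m x y z)) (m y x (m x y z)) (m z y (m x y z)))"
    "is_minority (\<lambda>x y z. m (m x y z) (m z x y) (m y z x))"
    by (rule is_minorityI; (intro mc ternary_proj)?; simp add: m)+
  then show ?thesis unfolding symmetrize_def by simp
qed

lemma minority_of_rainbow_values:
  assumes "is_minority m" "x \<in> A" "y \<in> A" "z \<in> A"
  shows "minority_of (rainbow_values m) x y z = m x y z"
  using is_minorityD[OF assms(1)] assms(2-4)
  unfolding minority_of_def rainbow_values_def three_def by auto

lemma rainbow_values_symmetrize:
  assumes m: "is_minority m" and v: "v = rainbow_values m"
  shows "rainbow_values (symmetrize v m) = symmetrized_values v"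
proof -
  have t: "ternary m" using m is_minorityD by blast
  have m_eq: "m x y z = minority_of v x y z" if "x \<in> A" "y \<in> A" "z \<in> A" for x y z
    using minority_of_rainbow_values[OF m that] v by simp
  have cl: "minority_of v x y z \<in> A" if "x \<in> A" "y \<in> A" "z \<in> A" for x y z
    using ternary_closed[OF t that] m_eq[OF that] by simp
  have A: "0 \<in> A" "1 \<in> A" "2 \<in> A" by (simp_all add: three_def)
  then show ?thesis
    unfolding symmetrized_values_def rainbow_values_def symmetrize_def by (simp add: m_eq cl del: One_nat_def)
qed

lemma sym_minority_if_not_shift_invariant:
  assumes m: "is_minority m" and n: "\<not> shift_invariant (rainbow_values m)"
  shows "\<exists>c\<in>A. ternary (sym_minority c)"
proof -
  define v where "v = rainbow_values m"
  define m1 where "m1 = symmetrize v m"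
  define m2 where "m2 = symmetrize (rainbow_values m1) m1"
  have m1: "is_minority m1" unfolding m1_def by (intro is_minority_symmetrize m)
  then have m2: "is_minority m2" unfolding m2_def by (rule is_minority_symmetrize)
  have cl: "p x y z \<in> three" if "is_minority p" "x \<in> A" "y \<in> A" "z \<in> A" for p x y z
    using that ternary_closed is_minorityD(1) by blast
  have A: "0 \<in> A" "1 \<in> A" "2 \<in> A" by (simp_all add: three_def)
  have "length v = 6" "set v \<subseteq> three"
    unfolding v_def rainbow_values_def using cl[OF m] A by (simp_all del: One_nat_def)
  then obtain c where "symmetrized_values (symmetrized_values v) = replicate 6 c"
    using symmetrized_twice_constant n unfolding v_def by blast
  moreover have "rainbow_values m1 = symmetrized_values v"
    unfolding m1_def by (rule rainbow_values_symmetrize[OF m v_def])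
  moreover have "rainbow_values m2 = symmetrized_values (rainbow_values m1)"
    unfolding m2_def by (rule rainbow_values_symmetrize[OF m1 refl])
  ultimately have rv: "rainbow_values m2 = replicate 6 c" by simp
  have "m2 x y z = sym_minority c x y z" if "x \<in> A" "y \<in> A" "z \<in> A" for x y z
    using minority_of_rainbow_values[OF m2 that] that
    unfolding rv sym_minority_def minority_of_def by (auto split: if_splits)
  then have "ternary (sym_minority c)"
    by (rule ternary_cong[OF is_minorityD(1)[OF m2]])
  moreover have "c = m2 0 1 2" using rv unfolding rainbow_values_def by (simp add: numeral_eq_Suc)
  then have "c \<in> A" using cl[OF m2] A by blast
  ultimately show ?thesis by blast
qed

text \<open>A minority operation commuting with the cycle is rotated to \<open>p\<close>, the first
  projection on even permutations. Composing \<open>g\<close> with the cyclic shifts of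
  \<open>p\<close> gives a minority operation that agrees with \<open>g\<close> there and so does
  not commute with the cycle.\<close>

lemma sym_minority_exists:
  assumes m: "is_minority m" and g: "ternary g" "g 1 2 0 \<noteq> (g 0 1 2 + 1) mod 3"
  shows "\<exists>c\<in>A. ternary (sym_minority c)"
proof (cases "shift_invariant (rainbow_values m)")
  case True
  note mD = is_minorityD[OF m]
  note mc = ternary_compose[OF mD(1)]
  have rot: "is_minority (\<lambda>x y z. m y z x)" "is_minority (\<lambda>x y z. m z x y)"
    by (rule is_minorityI; (intro mc ternary_proj)?; simp add: mD)+
  have E: "m 1 2 0 = Suc (m 0 1 2) mod 3" "m 2 0 1 = Suc (m 1 2 0) mod 3"
    using True unfolding shift_invariant_def rainbow_values_def by simp_all
  have "m 0 1 2 \<in> A" using ternary_closed[OF mD(1)] by (simp add: three_def)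
  then consider "m 0 1 2 = 0" | "m 0 1 2 = 1" | "m 0 1 2 = 2" unfolding three_def by auto
  then obtain p where p: "is_minority p" "p 0 1 2 = 0" "p 1 2 0 = 1" "p 2 0 1 = 2"
  proof cases
    case 1 then show ?thesis using that[OF m] E by simp
  next
    case 2 then show ?thesis using that[OF rot(2)] E by simp
  next
    case 3 then show ?thesis using that[OF rot(1)] E by simp
  qed
  note pD = is_minorityD[OF p(1)]
  define h where "h x y z = g (p x y z) (p y z x) (p z x y)" for x y z
  have "is_minority h"
    unfolding h_def
    by (rule is_minorityI; (intro ternary_compose[OF g(1)] ternary_compose[OF pD(1)] ternary_proj)?;
        simp add: pD ternary_idempotent[OF g(1)])
  moreover have "\<not> shift_invariant (rainbow_values h)"
    using g(2) p unfolding h_def shift_invariant_def rainbow_values_def by simp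
  ultimately show ?thesis by (rule sym_minority_if_not_shift_invariant)
next
  case False
  with m show ?thesis by (rule sym_minority_if_not_shift_invariant)
qed

end

subsection \<open>The parity operations\<close>

text \<open>In a list of odd length over \<open>p\<close>, \<open>q\<close>, \<open>c\<close>, one
  or all three counts are odd. Testing \<open>c\<close> first gives the element left after
  cancelling pairs, with default \<open>c\<close>.\<close>

definition parity_value :: "nat \<Rightarrow> nat \<Rightarrow> nat \<Rightarrow> nat list \<Rightarrow> nat" where
  "parity_value p q c xs =
     (if odd (count_list xs c) then c else if odd (count_list xs q) then q else p)"

lemma count_list_map_remove1:
  "i \<in> set is \<Longrightarrow> count_list (map f (remove1 i is)) a + count_list [f i] a = count_list (map f is) a"
  by (induction "is") auto

locale clone_with_sym_minority = idempotent_clone_on_three C for C +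
  fixes p q c :: nat
  assumes A_eq: "three = {p, q, c}" and distinct: "distinct [p, q, c]"
    and sym: "ternary (sym_minority c)"
begin

abbreviation "s \<equiv> sym_minority c"

lemma pqc: "p \<noteq> q" "q \<noteq> p" "p \<noteq> c" "c \<noteq> p" "q \<noteq> c" "c \<noteq> q"
  using distinct by auto

text \<open>The nested equality says that an odd number of the three statements hold: on the classes
  {c} and {p, q}, \<open>s\<close> is addition modulo 2.\<close>

lemma s_eq_c: "s x y z = c \<longleftrightarrow> ((x = c) = ((y = c) = (z = c)))"
  if "x \<in> A" "y \<in> A" "z \<in> A"
  using that unfolding A_eq by (elim insertE emptyE) (simp_all add: sym_minority_def pqc)

text \<open>Being equal to \<^term>\<open>c\<close> is a congruence of \<^term>\<open>s\<close>, and on each congruence class \<^term>\<open>s\<close> provides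
  a case distinction on whether a third argument is \<^term>\<open>c\<close>.\<close>

lemma s_select: "s (s x y z) y z = (if z = c then y else x)"
  if "x \<in> A" "y \<in> A" "z \<in> A" "x = c \<longleftrightarrow> y = c"
  using that unfolding A_eq by (elim insertE emptyE) (simp_all add: sym_minority_def pqc)

lemma admits_if:
  assumes F: "admits n F" and G: "admits n G" and Z: "admits n Z"
    and class_eq: "\<And>xs. xs \<in> tuples A n \<Longrightarrow> F xs = c \<longleftrightarrow> G xs = c"
  shows "admits n (\<lambda>xs. if Z xs = c then G xs else F xs)"
proof (rule admits_cong)
  show "admits n (\<lambda>xs. s (s (F xs) (G xs) (Z xs)) (G xs) (Z xs))"
    by (intro ternary_apply[OF sym] F G Z)
qed (simp add: s_select admits_closed[OF F] admits_closed[OF G] admits_closed[OF Z] class_eq)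

abbreviation "pv \<equiv> parity_value p q c"

lemma pv_A: "pv ys \<in> A"
  unfolding parity_value_def A_eq by auto

lemma pv_eq_c: "pv ys = c \<longleftrightarrow> odd (count_list ys c)"
  using distinct unfolding parity_value_def by auto

lemma s_pv:
  assumes "a \<in> A" "b \<in> A" "pv ys = c \<Longrightarrow> a = c \<longleftrightarrow> b = c"
  shows "s (pv ys) a b = pv (a # b # ys)"
proof -
  have "odd (count_list ys c) \<longrightarrow> (a = c \<longleftrightarrow> b = c)" using assms(3) unfolding pv_eq_c by blast
  with assms(1,2) show ?thesis unfolding A_eq
    by (elim insertE emptyE) (simp_all add: parity_value_def sym_minority_def pqc)
qed

abbreviation "pvi is xs \<equiv> pv (map ((!) xs) is)"

text \<open>The nested term \<open>s (pv ys) a b\<close> computes \<open>pv (a # b # ys)\<close> unless exactly one of \<open>a\<close>, \<open>b\<close> is \<open>c\<close>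
  and \<open>ys\<close> contains an odd number of \<open>c\<close>. In that case exchanging an argument \<open>c\<close> of \<open>ys\<close> with the
  other one of \<open>a\<close>, \<open>b\<close> gives a nested term with the right value; the case distinction selects it.\<close>

lemma admits_pv_correct:
  assumes B: "admits n B" and Bc: "\<And>xs. xs \<in> tuples A n \<Longrightarrow> B xs = c \<longleftrightarrow> pvi (j # k # is) xs = c"
    and P: "\<And>i. i \<in> set is \<Longrightarrow> admits n (pvi (k # remove1 i is))"
    and idx: "j < n" "k < n" "set is \<subseteq> {..<n}"
    and L: "set L \<subseteq> set is"
  shows "admits n (\<lambda>xs. if (\<exists>i\<in>set L. xs ! i = c) \<and> xs ! j = c then pvi (j # k # is) xs else B xs)"
  using L
proof (induction L)
  case Nil
  then show ?case using B by simp
next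
  case (Cons i L)
  let ?t = "pvi (j # k # is)"
  let ?G = "\<lambda>xs. if (\<exists>i\<in>set L. xs ! i = c) \<and> xs ! j = c then ?t xs else B xs"
  \<comment> \<open>The indices are those of \<open>?t\<close>, but \<open>i\<close> and
    \<open>j\<close> are now the outer arguments. Both are \<open>c\<close> in the case to be
    corrected, so \<open>s_pv\<close> applies.\<close>
  let ?P = "\<lambda>xs. s (pvi (k # remove1 i is) xs) (xs ! i) (xs ! j)"
  have i: "i \<in> set is" "i < n" using Cons.prems idx by auto
  have G: "admits n ?G" using Cons by simp
  have Pi: "admits n ?P" by (intro ternary_apply[OF sym] P admits_proj i idx)
  have Gc: "?G xs = c \<longleftrightarrow> ?t xs = c" if "xs \<in> tuples A n" for xs using Bc[OF that] by simp
  have cnt: "count_list (map ((!) xs) is) a = count_list (map ((!) xs) (remove1 i is)) a + count_list [xs ! i] a" for xs a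
    using count_list_map_remove1[OF i(1), of "(!) xs" a] by simp
  have Pc: "?P xs = c \<longleftrightarrow> ?t xs = c" if "xs \<in> tuples A n" for xs
    using s_eq_c[OF pv_A tuples_nth[OF that i(2)] tuples_nth[OF that idx(1)]]
    by (auto simp: pv_eq_c cnt)
  have Pt: "?P xs = ?t xs" if "xs \<in> tuples A n" "xs ! i = c" "xs ! j = c" for xs
  proof -
    have "c \<in> A" unfolding A_eq by simp
    then have "?P xs = pv (c # c # map ((!) xs) (k # remove1 i is))" using that s_pv[of c c] by simp
    also have "\<dots> = ?t xs" unfolding parity_value_def using that by (simp add: cnt)
    finally show ?thesis .
  qed
  have 1: "admits n (\<lambda>xs. if xs ! j = c then ?P xs else ?G xs)"
    by (rule admits_if[OF G Pi admits_proj[OF idx(1)]]) (simp only: Gc Pc)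
  have "admits n (\<lambda>xs. if xs ! i = c then (if xs ! j = c then ?P xs else ?G xs) else ?G xs)"
  proof (rule admits_if[OF G 1 admits_proj[OF i(2)]])
    fix xs assume "xs \<in> tuples A n"
    then show "?G xs = c \<longleftrightarrow> (if xs ! j = c then ?P xs else ?G xs) = c"
      using Gc[of xs] Pc[of xs] by presburger
  qed
  then show ?case
    by (rule admits_cong) (use Pt in auto)
qed

text \<open>Induction in steps of two indices. The nested term is corrected where \<open>c\<close>
  occurs both in \<open>ks\<close> and at \<open>j\<close>, then, with roles exchanged, in
  \<open>ks\<close> and at \<open>k\<close>; elsewhere \<open>s_pv\<close> applies.\<close>

lemma admits_pv:
  assumes "odd (length is)" "set is \<subseteq> {..<n}"
  shows "admits n (pvi is)"
  using assms
proof (induction "length is" arbitrary: "is" rule: less_induct)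
  case less
  then consider i where "is = [i]" | j k ks where "is = j # k # ks" "odd (length ks)"
    by (cases "is" rule: remdups_adj.cases) auto
  then show ?case
  proof cases
    case 1
    then have "i < n" using less.prems by simp
    then show ?thesis
      by (rule admits_cong[OF admits_proj])
        (use 1 distinct tuples_nth[OF _ \<open>i < n\<close>] in \<open>auto simp: parity_value_def A_eq\<close>)
  next
    case 2
    have idx: "j < n" "k < n" "set ks \<subseteq> {..<n}" using less.prems 2 by auto
    \<comment> \<open>Trading an index of \<open>ks\<close> for \<open>l\<close> keeps the length,
      so the induction hypothesis covers the terms used for correction.\<close>
    have rec: "admits n (pvi (l # remove1 i ks))" if "l < n" "i \<in> set ks" for l i
    proof (rule less.hyps)
      have "set (remove1 i ks) \<subseteq> {..<n}" using idx(3) set_remove1_subset by fast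
      then show "set (l # remove1 i ks) \<subseteq> {..<n}" using that by simp
      have len: "length (l # remove1 i ks) = length ks"
        using that(2) length_pos_if_in_set[OF that(2)] by (simp add: length_remove1)
      show "length (l # remove1 i ks) < length is" "odd (length (l # remove1 i ks))"
        unfolding len using 2 by simp_all
    qed
    let ?t = "pvi (j # k # ks)"
    have swap: "pvi (k # j # ks) xs = ?t xs" for xs
      using distinct by (simp add: parity_value_def)
    let ?B = "\<lambda>xs. s (pvi ks xs) (xs ! j) (xs ! k)"
    have ks: "admits n (pvi ks)"
    proof (rule less.hyps)
      show "length ks < length is" unfolding 2(1) by simp
    qed (use 2(2) idx(3) in auto)
    have B: "admits n ?B"
      by (rule ternary_apply[OF sym ks admits_proj[OF idx(1)] admits_proj[OF idx(2)]])
    have Bc: "?B xs = c \<longleftrightarrow> ?t xs = c" if "xs \<in> tuples A n" for xs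
      using s_eq_c[OF pv_A tuples_nth[OF that idx(1)] tuples_nth[OF that idx(2)]]
      by (auto simp: pv_eq_c)
    let ?B' = "\<lambda>xs. if (\<exists>i\<in>set ks. xs ! i = c) \<and> xs ! j = c then ?t xs else ?B xs"
    have B': "admits n ?B'"
      by (rule admits_pv_correct[OF B Bc rec[OF idx(2)] idx subset_refl])
    have B'c: "?B' xs = c \<longleftrightarrow> pvi (k # j # ks) xs = c" if "xs \<in> tuples A n" for xs
      using Bc[OF that] unfolding swap by presburger
    have "admits n (\<lambda>xs. if (\<exists>i\<in>set ks. xs ! i = c) \<and> xs ! k = c then pvi (k # j # ks) xs else ?B' xs)"
      using B' B'c rec[OF idx(1)] idx(2,1,3) subset_refl by (rule admits_pv_correct)
    then have "admits n ?t"
    proof (rule admits_cong)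
      fix xs assume xs: "xs \<in> tuples A n"
      show "(if (\<exists>i\<in>set ks. xs ! i = c) \<and> xs ! k = c then pvi (k # j # ks) xs else ?B' xs) = ?t xs"
      proof (cases "(\<exists>i\<in>set ks. xs ! i = c) \<and> (xs ! k = c \<or> xs ! j = c)")
        case True
        then show ?thesis unfolding swap by presburger
      next
        case False
        have "?B xs = ?t xs"
        proof -
          have "s (pvi ks xs) (xs ! j) (xs ! k) = pv (xs ! j # xs ! k # map ((!) xs) ks)"
          proof (rule s_pv[OF tuples_nth[OF xs idx(1)] tuples_nth[OF xs idx(2)]])
            assume "pvi ks xs = c"
            then have "c \<in> set (map ((!) xs) ks)" unfolding pv_eq_c by (metis count_notin even_zero)
            then show "xs ! j = c \<longleftrightarrow> xs ! k = c" using False by auto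
          qed
          then show ?thesis by simp
        qed
        then show ?thesis using False by auto
      qed
    qed
    then show ?thesis using 2 by simp
  qed
qed

end

subsection \<open>The clone of idempotent affine operations modulo 2\<close>

lemma affine2_rel_iff:
  "r \<in> affine2_rel \<longleftrightarrow> (\<exists>x y z w. r = [x, y, z, w] \<and> {x, y, z, w} \<subseteq> {0, 1} \<and> even (x + y + z + w))"
proof
  assume "r \<in> affine2_rel"
  then show "\<exists>x y z w. r = [x, y, z, w] \<and> {x, y, z, w} \<subseteq> {0, 1} \<and> even (x + y + z + w)"
    unfolding affine2_rel_def by auto
next
  assume "\<exists>x y z w. r = [x, y, z, w] \<and> {x, y, z, w} \<subseteq> {0, 1} \<and> even (x + y + z + w)"
  then obtain x y z w where r: "r = [x, y, z, w]" "x \<in> {0, 1}" "y \<in> {0, 1}" "z \<in> {0, 1}" "w \<in> {0, 1}"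
      "even (x + y + z + w)" by auto
  then have "w = nat ((int x - int y + int z) mod 2)" by auto
  with r show "r \<in> affine2_rel" unfolding affine2_rel_def by blast
qed

lemma Z2_iff:
  "(n, f) \<in> Z2 \<longleftrightarrow> 1 \<le> n \<and> f \<in> ops {0, 1} n \<and>
     f (replicate n 0) = 0 \<and> f (replicate n 1) = 1 \<and>
     (\<forall>x y z w. {x, y, z, w} \<subseteq> tuples {0, 1} n \<and> (\<forall>i<n. even (x ! i + y ! i + z ! i + w ! i))
        \<longrightarrow> even (f x + f y + f z + f w))"
  (is "_ \<longleftrightarrow> ?pos \<and> ?ops \<and> ?f0 \<and> ?f1 \<and> ?aff")
proof -
  have const: "preserves n f 1 {[a]} \<longleftrightarrow> f (replicate n a) = a" for a
  proof -
    have "length rs = n \<and> set rs \<subseteq> {[a]} \<longleftrightarrow> rs = replicate n [a]" for rs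
      by (auto intro: replicate_eqI)
    then show ?thesis unfolding preserves_def by simp
  qed
  have aff: "preserves n f 4 affine2_rel \<longleftrightarrow> ?aff" if f: ?ops
  proof
    assume p: "preserves n f 4 affine2_rel"
    show ?aff
    proof (intro allI impI, elim conjE)
      fix x y z w assume t: "{x, y, z, w} \<subseteq> tuples {0, 1} n"
        and e: "\<forall>i<n. even (x ! i + y ! i + z ! i + w ! i)"
      let ?rs = "map (\<lambda>i. [x ! i, y ! i, z ! i, w ! i]) [0..<n]"
      have "set ?rs \<subseteq> affine2_rel"
        using t e tuples_nth[of _ "{0, 1}" n] by (auto simp: affine2_rel_iff)
      moreover have "length ?rs = n" by simp
      ultimately have "map (\<lambda>j. f (map (\<lambda>t. t ! j) ?rs)) [0..<4] \<in> affine2_rel"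
        using p unfolding preserves_def by blast
      moreover have "map (\<lambda>i. u ! i) [0..<n] = u" if "u \<in> tuples {0, 1} n" for u
        using that map_nth[of u] unfolding tuples_def by simp
      ultimately have "[f x, f y, f z, f w] \<in> affine2_rel"
        using t by (simp add: upt_rec o_def)
      then show "even (f x + f y + f z + f w)" unfolding affine2_rel_iff by simp
    qed
  next
    assume a: ?aff
    show "preserves n f 4 affine2_rel"
      unfolding preserves_def
    proof (intro allI impI, elim conjE)
      fix rs assume rs: "length rs = n" "set rs \<subseteq> affine2_rel"
      let ?c = "\<lambda>j. map (\<lambda>t. t ! j) rs"
      have r: "\<exists>x y z w. rs ! i = [x, y, z, w] \<and> {x, y, z, w} \<subseteq> {0, 1} \<and> even (x + y + z + w)" if "i < n" for i
        using subsetD[OF rs(2), of "rs ! i"] rs(1) that unfolding affine2_rel_iff by simp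
      have mem: "?c j \<in> tuples {0, 1} n" if "j < 4" for j
      proof -
        have "rs ! i ! j \<in> {0, 1}" if "i < n" for i
          using r[OF that] \<open>j < 4\<close> by (auto simp: less_Suc_eq numeral_eq_Suc)
        then show ?thesis using rs(1) by (intro tuplesI) simp_all
      qed
      have "even (?c 0 ! i + ?c 1 ! i + ?c 2 ! i + ?c 3 ! i)" if "i < n" for i
        using r[OF that] rs(1) that by (auto simp: numeral_eq_Suc)
      then have "even (f (?c 0) + f (?c 1) + f (?c 2) + f (?c 3))"
        using a mem by simp
      moreover have "f (?c j) \<in> {0, 1}" if "j < 4" for j
        using f mem[OF that] unfolding ops_def by blast
      ultimately have "[f (?c 0), f (?c 1), f (?c 2), f (?c 3)] \<in> affine2_rel"
        unfolding affine2_rel_iff by simp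
      then show "map (\<lambda>j. f (?c j)) [0..<4] \<in> affine2_rel"
        by (simp add: upt_rec numeral_2_eq_2 numeral_3_eq_3)
    qed
  qed
  show ?thesis unfolding Z2_def Pol_def using const aff by auto
qed

text \<open>The indices are the coordinates whose unit tuple is sent to 1. Affinity builds up the
  value of an indicator tuple one coordinate at a time; idempotence at 1 makes their number
  odd.\<close>

lemma Z2_parity:
  assumes f: "(n, f) \<in> Z2"
  obtains "is" where "set is \<subseteq> {..<n}" "odd (length is)"
    "\<And>xs. xs \<in> tuples {0, 1} n \<Longrightarrow> f xs = 1 \<longleftrightarrow> odd (count_list (map ((!) xs) is) 1)"
proof -
  define ind where "ind X = map (\<lambda>i. if i \<in> X then 1 else 0 :: nat) [0..<n]" for X
  have ind: "ind X \<in> tuples {0, 1} n" for X unfolding ind_def tuples_def by auto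
  have fb: "f xs \<in> {0, 1}" if "xs \<in> tuples {0, 1} n" for xs
    using f that unfolding Z2_iff ops_def by blast
  define S where "S = {i. i < n \<and> f (ind {i}) = 1}"
  have f_ind: "f (ind X) = 1 \<longleftrightarrow> odd (card (X \<inter> S))" if "finite X" "X \<subseteq> {..<n}" for X
    using that
  proof (induction X)
    case empty
    have "ind {} = replicate n 0" unfolding ind_def by (simp add: map_replicate_const)
    then show ?case using f unfolding Z2_iff by simp
  next
    case (insert i X)
    have 0: "ind {} = replicate n 0" unfolding ind_def by (simp add: map_replicate_const)
    have "even (f (ind (insert i X)) + f (ind X) + f (ind {i}) + f (ind {}))"
    proof -
      have "{ind (insert i X), ind X, ind {i}, ind {}} \<subseteq> tuples {0, 1} n" using ind by blast
      moreover have "\<forall>k<n. even (ind (insert i X) ! k + ind X ! k + ind {i} ! k + ind {} ! k)"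
        using insert.hyps unfolding ind_def by simp
      ultimately show ?thesis using f unfolding Z2_iff by blast
    qed
    moreover have "f (ind {}) = 0" using f 0 unfolding Z2_iff by simp
    moreover have "f (ind (insert i X)) \<in> {0, 1}" "f (ind X) \<in> {0, 1}" "f (ind {i}) \<in> {0, 1}"
      using fb ind by blast+
    moreover have "f (ind X) = 1 \<longleftrightarrow> odd (card (X \<inter> S))" using insert by simp
    moreover have "i \<in> S \<longleftrightarrow> f (ind {i}) = 1" using insert.prems unfolding S_def by simp
    moreover have "card (insert i X \<inter> S) = card (X \<inter> S) + (if i \<in> S then 1 else 0)"
      using insert.hyps by (auto simp: card_insert_if)
    ultimately show ?case by (auto split: if_splits)
  qed
  have S: "finite S" unfolding S_def by simp
  let ?is = "sorted_list_of_set S"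
  have par: "f xs = 1 \<longleftrightarrow> odd (count_list (map ((!) xs) ?is) 1)" if xs: "xs \<in> tuples {0, 1} n" for xs
  proof -
    let ?X = "{i. i < n \<and> xs ! i = 1}"
    have "xs = ind ?X"
    proof (rule nth_equalityI)
      show "length xs = length (ind ?X)" using xs unfolding ind_def tuples_def by simp
      show "xs ! i = ind ?X ! i" if "i < length xs" for i
        using that tuples_nth[OF xs, of i] xs unfolding ind_def tuples_def by auto
    qed
    then have "f xs = 1 \<longleftrightarrow> odd (card (?X \<inter> S))" using f_ind[of ?X] by auto
    moreover have "count_list (map ((!) xs) ?is) 1 = card (?X \<inter> S)"
    proof -
      have "count_list (map ((!) xs) ?is) 1 = length (filter (\<lambda>i. xs ! i = 1) ?is)"
        by (simp add: count_list_eq_length_filter filter_map o_def eq_commute)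
      also have "\<dots> = card (set (filter (\<lambda>i. xs ! i = 1) ?is))"
        by (rule distinct_card[symmetric]) simp
      also have "set (filter (\<lambda>i. xs ! i = 1) ?is) = ?X \<inter> S" using S unfolding S_def by auto
      finally show ?thesis .
    qed
    ultimately show ?thesis by simp
  qed
  have "replicate n 1 \<in> tuples {0, 1} n" by (auto simp: tuples_def)
  then have "odd (count_list (map ((!) (replicate n (1::nat))) ?is) 1)" using par f unfolding Z2_iff by blast
  moreover have "map ((!) (replicate n (1::nat))) ?is = map (\<lambda>_. 1) ?is"
    using S unfolding S_def by (intro map_cong) auto
  ultimately have "odd (count_list (map (\<lambda>_. 1::nat) ?is) 1)" by metis
  then have "odd (length ?is)" by (simp add: count_list_eq_length_filter filter_map o_def)
  moreover have "set ?is \<subseteq> {..<n}" using S unfolding S_def by auto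
  ultimately show ?thesis using that par by blast
qed

section \<open>The minion homomorphism from \<open>Z2\<close>\<close>

context clone_with_sym_minority
begin

text \<open>Feeding \<open>f\<close> the indicator tuples of \<open>c\<close> and \<open>q\<close>
  reads off parities without choosing indices, so compatibility with minors is a direct
  computation.\<close>

definition from_Z2 :: "nat \<Rightarrow> (nat list \<Rightarrow> nat) \<Rightarrow> nat list \<Rightarrow> nat" where
  "from_Z2 n f = restrict (\<lambda>xs. if f (map (\<lambda>x. of_bool (x = c)) xs) = 1 then c
     else if f (map (\<lambda>x. of_bool (x = q)) xs) = 1 then q else p) (tuples A n)"

lemma from_Z2_mem:
  assumes f: "(n, f) \<in> Z2"
  shows "(n, from_Z2 n f) \<in> C"
proof -
  obtain "is" where i: "set is \<subseteq> {..<n}" "odd (length is)"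
    and par: "\<And>xs. xs \<in> tuples {0, 1} n \<Longrightarrow> f xs = 1 \<longleftrightarrow> odd (count_list (map ((!) xs) is) 1)"
    using Z2_parity[OF f] by blast
  have "f (map (\<lambda>x. of_bool (x = a) :: nat) xs) = 1 \<longleftrightarrow> odd (count_list (map ((!) xs) is) a)"
    if "xs \<in> tuples A n" for xs a
  proof -
    have "map (\<lambda>x. of_bool (x = a) :: nat) xs \<in> tuples {0, 1} n" using that unfolding tuples_def by auto
    then have "f (map (\<lambda>x. of_bool (x = a) :: nat) xs) = 1
        \<longleftrightarrow> odd (count_list (map ((!) (map (\<lambda>x. of_bool (x = a) :: nat) xs)) is) 1)" by (rule par)
    also have "map ((!) (map (\<lambda>x. of_bool (x = a) :: nat) xs)) is = map (\<lambda>i. of_bool (xs ! i = a) :: nat) is"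
      using i(1) that unfolding tuples_def by auto
    also have "count_list \<dots> (1::nat) = count_list (map ((!) xs) is) a"
      by (induction "is") auto
    finally show ?thesis .
  qed
  then have "from_Z2 n f = restrict (pvi is) (tuples A n)"
    unfolding from_Z2_def by (intro restrict_ext) (simp add: parity_value_def)
  then show ?thesis using admits_pv[OF i(2,1)] unfolding admits_def by simp
qed

lemma minion_hom_from_Z2: "minion_hom {0, 1} Z2 A C from_Z2"
  unfolding minion_hom_def
proof (intro conjI ballI; clarify)
  fix n f assume "(n, f) \<in> Z2"
  then show "(n, from_Z2 n f) \<in> C" by (rule from_Z2_mem)
next
  fix n r :: nat and f \<sigma> assume f: "(n, f) \<in> Z2" and r: "1 \<le> r" and \<sigma>: "\<forall>i<n. \<sigma> i < r"
  show "from_Z2 r (minor {0, 1} n r \<sigma> f) = minor A n r \<sigma> (from_Z2 n f)"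
  proof
    fix xs
    show "from_Z2 r (minor {0, 1} n r \<sigma> f) xs = minor A n r \<sigma> (from_Z2 n f) xs"
    proof (cases "xs \<in> tuples A r")
      case True
      have t: "map (\<lambda>i. xs ! \<sigma> i) [0..<n] \<in> tuples A n"
        using tuples_nth[OF True] \<sigma> unfolding tuples_def by auto
      have "minor {0, 1} n r \<sigma> f (map (\<lambda>x. of_bool (x = a) :: nat) xs)
          = f (map (\<lambda>x. of_bool (x = a)) (map (\<lambda>i. xs ! \<sigma> i) [0..<n]))" for a
      proof -
        have "map (\<lambda>x. of_bool (x = a) :: nat) xs \<in> tuples {0, 1} r" using True unfolding tuples_def by auto
        moreover have "map (\<lambda>i. map (\<lambda>x. of_bool (x = a) :: nat) xs ! \<sigma> i) [0..<n]
            = map (\<lambda>x. of_bool (x = a)) (map (\<lambda>i. xs ! \<sigma> i) [0..<n])"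
          using True \<sigma> unfolding tuples_def by simp
        ultimately show ?thesis unfolding minor_def by (simp only: restrict_apply')
      qed
      then show ?thesis using True t unfolding from_Z2_def minor_def[of A] by simp
    qed (simp add: from_Z2_def minor_def)
  qed
qed

end

subsection \<open>The homomorphism to affine operations modulo 2\<close>

context idempotent_clone_on_three
begin

text \<open>Take a minimal set of near-unanimous triples on which no operation of the clone acts as a
  majority operation. It has at least three elements because any two near-unanimous triples share
  a coordinate at which both have their majority value. Restricting to three of its elements gives
  a relation that separates \<open>(t1, t2, t3)\<close> from its three one-coordinate modifications.\<close>

lemma no_majority_relation:
  assumes "\<not> has_majority A C"
  obtains R :: "(nat \<times> nat \<times> nat) set" and t1 t2 t3 a1 a2 a3 where
    "R \<subseteq> A \<times> A \<times> A"
    "(a1, t2, t3) \<in> R" "(t1, a2, t3) \<in> R" "(t1, t2, a3) \<in> R" "(t1, t2, t3) \<notin> R"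
    "\<And>n f u v w. admits n f \<Longrightarrow> length u = n \<Longrightarrow> length v = n \<Longrightarrow> length w = n \<Longrightarrow>
       (\<And>i. i < n \<Longrightarrow> (u ! i, v ! i, w ! i) \<in> R) \<Longrightarrow> (f u, f v, f w) \<in> R"
proof -
  define NU where "NU = {u \<in> tuples A 3. u ! 0 = u ! 1 \<or> u ! 1 = u ! 2 \<or> u ! 0 = u ! 2}"
  \<comment> \<open>If the first two entries of a near-unanimous triple differ, the last equals one
    of them.\<close>
  define maj where "maj u = (if u ! 0 = u ! 1 then u ! 0 else u ! 2)" for u :: "nat list"
  define agree where "agree F K \<longleftrightarrow> (\<forall>u\<in>K. F u = maj u)" for F :: "nat list \<Rightarrow> nat" and K
  define bad where "bad K \<longleftrightarrow> K \<subseteq> NU \<and> \<not> (\<exists>F. (3, F) \<in> C \<and> agree F K)" for K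
  have finA: "finite A" unfolding three_def by simp
  have "finite (tuples A 3)"
    using finite_lists_length_eq[OF finA, of 3] unfolding tuples_def by (simp add: conj_commute)
  then have fin: "finite NU" unfolding NU_def by simp
  have NU_A: "u \<in> tuples A 3" if "u \<in> NU" for u using that unfolding NU_def by simp
  have maj_A: "maj u \<in> A" if "u \<in> NU" for u
    using tuples_nth[OF NU_A[OF that]] unfolding maj_def by simp
  have "bad NU"
    unfolding bad_def
  proof (intro conjI subset_refl notI, elim exE conjE)
    fix F assume F: "(3, F) \<in> C" "agree F NU"
    have "F [x, y, y] = y \<and> F [y, x, y] = y \<and> F [y, y, x] = y" if "x \<in> A" "y \<in> A" for x y
    proof -
      have "[x, y, y] \<in> NU" "[y, x, y] \<in> NU" "[y, y, x] \<in> NU"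
        using that unfolding NU_def by (simp_all add: tuples_3)
      then show ?thesis using F(2) unfolding agree_def maj_def by auto
    qed
    then show False using assms F(1) unfolding has_majority_def by blast
  qed
  then obtain K where K: "bad K" and K_min: "\<And>L. bad L \<Longrightarrow> card K \<le> card L"
    using ex_has_least_nat[of bad NU card] by blast
  have K_NU: "K \<subseteq> NU" using K unfolding bad_def by blast
  have K_fin: "finite K" using finite_subset[OF K_NU fin] .
  have Fk: "\<exists>F. (3, F) \<in> C \<and> agree F (K - {k})" if "k \<in> K" for k
  proof -
    have "card (K - {k}) < card K" using that K_fin by (rule card_Diff1_less[rotated])
    then have "\<not> bad (K - {k})" using K_min leD by blast
    then show ?thesis using K_NU unfolding bad_def by blast
  qed
  have pair: "\<not> K \<subseteq> {u, v}" if "u \<in> NU" "v \<in> NU" for u v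
  proof
    assume sub: "K \<subseteq> {u, v}"
    have "\<exists>i<3. u ! i = maj u \<and> v ! i = maj v"
    proof -
      have "u ! 0 = u ! 1 \<or> u ! 1 = u ! 2 \<or> u ! 0 = u ! 2" "v ! 0 = v ! 1 \<or> v ! 1 = v ! 2 \<or> v ! 0 = v ! 2"
        using that unfolding NU_def by blast+
      then have "u ! 0 = maj u \<and> v ! 0 = maj v \<or> u ! 1 = maj u \<and> v ! 1 = maj v \<or> u ! 2 = maj u \<and> v ! 2 = maj v"
        unfolding maj_def by auto
      then have "\<exists>i\<in>{0, 1, 2}. u ! i = maj u \<and> v ! i = maj v" by simp
      then obtain i where "i \<in> {0, 1, 2}" "u ! i = maj u" "v ! i = maj v" by blast
      then show ?thesis by (intro exI[of _ i]) auto
    qed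
    then obtain i where i: "i < 3" "u ! i = maj u" "v ! i = maj v" by blast
    have "(3, proj A 3 i) \<in> C" using clone i(1) unfolding is_clone_def by simp
    moreover have "agree (proj A 3 i) K"
      using sub i NU_A that unfolding agree_def proj_def by auto
    ultimately show False using K unfolding bad_def by blast
  qed
  have "[0, 0, 0] \<in> NU" unfolding NU_def by (simp add: tuples_3 three_def)
  then obtain k1 where k1: "k1 \<in> K" using pair by blast
  then obtain k2 where k2: "k2 \<in> K" "k2 \<noteq> k1" using pair[of k1 k1] K_NU by blast
  then obtain k3 where k3: "k3 \<in> K" "k3 \<noteq> k1" "k3 \<noteq> k2" using pair[of k1 k2] k1 K_NU by blast
  \<comment> \<open>Minimality of \<open>K\<close> supplies operations wrong at just one of the
    three triples; badness of \<open>K\<close> excludes the three majority values together.\<close>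
  define R where "R = {(F k1, F k2, F k3) |F. (3, F) \<in> C \<and> agree F (K - {k1, k2, k3})}"
  have RI: "(F k1, F k2, F k3) \<in> R" if "(3, F) \<in> C" "agree F (K - {k1, k2, k3})" for F
    unfolding R_def using that by blast
  note ks = k1 k2 k3
  have k_t: "k \<in> tuples A 3" if "k \<in> K" for k using that K_NU NU_A by blast
  obtain F1 where F1: "(3, F1) \<in> C" "agree F1 (K - {k1})" using Fk[OF k1] by blast
  obtain F2 where F2: "(3, F2) \<in> C" "agree F2 (K - {k2})" using Fk[OF k2(1)] by blast
  obtain F3 where F3: "(3, F3) \<in> C" "agree F3 (K - {k3})" using Fk[OF k3(1)] by blast
  show ?thesis
  proof (rule that[of R "F1 k1" "maj k2" "maj k3" "maj k1" "F2 k2" "F3 k3"])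
    have "F k \<in> A" if "(3, F) \<in> C" "k \<in> K" for F k
      using admits_closed[OF admits_mem[OF that(1)] k_t[OF that(2)]] .
    then show "R \<subseteq> A \<times> A \<times> A" unfolding R_def using ks by blast
    have "F1 k2 = maj k2" "F1 k3 = maj k3" "agree F1 (K - {k1, k2, k3})"
      using F1(2) ks unfolding agree_def by auto
    then show "(F1 k1, maj k2, maj k3) \<in> R" using RI[OF F1(1)] by simp
    have "F2 k1 = maj k1" "F2 k3 = maj k3" "agree F2 (K - {k1, k2, k3})"
      using F2(2) ks unfolding agree_def by auto
    then show "(maj k1, F2 k2, maj k3) \<in> R" using RI[OF F2(1)] by simp
    have "F3 k1 = maj k1" "F3 k2 = maj k2" "agree F3 (K - {k1, k2, k3})"
      using F3(2) ks unfolding agree_def by auto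
    then show "(maj k1, maj k2, F3 k3) \<in> R" using RI[OF F3(1)] by simp
    show "(maj k1, maj k2, maj k3) \<notin> R"
    proof
      assume "(maj k1, maj k2, maj k3) \<in> R"
      then obtain F where F: "(3, F) \<in> C" "agree F (K - {k1, k2, k3})"
        "F k1 = maj k1" "F k2 = maj k2" "F k3 = maj k3" unfolding R_def by auto
      then have "agree F K" unfolding agree_def by blast
      then show False using K F(1) unfolding bad_def by blast
    qed
  next
    fix n f u v w
    assume f: "admits n f" and len: "length u = n" "length v = n" "length w = n"
      and rows: "\<And>i. i < n \<Longrightarrow> (u ! i, v ! i, w ! i) \<in> R"
    have "\<exists>F. (3, F) \<in> C \<and> agree F (K - {k1, k2, k3}) \<and> F k1 = u ! i \<and> F k2 = v ! i \<and> F k3 = w ! i"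
      if "i < n" for i using rows[OF that] unfolding R_def by auto
    then obtain F where F: "\<And>i. i < n \<Longrightarrow> (3, F i) \<in> C \<and> agree (F i) (K - {k1, k2, k3}) \<and>
        F i k1 = u ! i \<and> F i k2 = v ! i \<and> F i k3 = w ! i" by metis
    let ?gs = "map F [0..<n]"
    let ?G = "\<lambda>xs. f (map (\<lambda>g. g xs) ?gs)"
    have "admits 3 ?G"
      by (rule admits_compose[OF f]) (use F admits_mem in auto)
    then have G: "(3, restrict ?G (tuples A 3)) \<in> C" unfolding admits_def .
    have cols: "map (\<lambda>g. g k1) ?gs = u" "map (\<lambda>g. g k2) ?gs = v" "map (\<lambda>g. g k3) ?gs = w"
      using F len by (auto intro!: nth_equalityI)
    \<comment> \<open>Idempotence of \<open>f\<close> keeps the common value of the row witnesses on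
      the rest of \<open>K\<close>.\<close>
    have "?G k = maj k" if "k \<in> K - {k1, k2, k3}" for k
    proof -
      have "map (\<lambda>g. g k) ?gs = replicate n (maj k)"
      proof (rule nth_equalityI)
        fix i assume "i < length (map (\<lambda>g. g k) ?gs)"
        then have "i < n" by simp
        then have "F i k = maj k" using F that unfolding agree_def by blast
        then show "map (\<lambda>g. g k) ?gs ! i = replicate n (maj k) ! i" using \<open>i < n\<close> by simp
      qed simp
      moreover have "k \<in> NU" using that K_NU by blast
      ultimately show ?thesis using admits_idempotent[OF f maj_A] by simp
    qed
    then have "agree (restrict ?G (tuples A 3)) (K - {k1, k2, k3})"
      unfolding agree_def using k_t by simp
    then have "(restrict ?G (tuples A 3) k1, restrict ?G (tuples A 3) k2, restrict ?G (tuples A 3) k3) \<in> R"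
      by (rule RI[OF G])
    then show "(f u, f v, f w) \<in> R" using k_t ks cols by simp
  qed
qed

text \<open>\<open>phi\<close> is the graph of x + 1 modulo 3. Identifying the arguments of a
  violating operation that receive the same of its three pairs leaves a ternary operation.\<close>

lemma not_shift_invariant_op:
  assumes "\<not> clone_preserves C 2 phi"
  obtains g where "ternary g" "g 1 2 0 \<noteq> (g 0 1 2 + 1) mod 3"
proof -
  obtain n f rs where f: "(n, f) \<in> C" and rs: "length rs = n" "set rs \<subseteq> phi"
    and nphi: "map (\<lambda>j. f (map (\<lambda>t. t ! j) rs)) [0..<2] \<notin> phi"
    using assms unfolding clone_preserves_def preserves_def by auto
  define g where "g x y z = f (map (\<lambda>r. if r = [0, 1] then x else if r = [1, 2] then y else z) rs)" for x y z
  let ?sel = "\<lambda>(r :: nat list) xs. if r = [0, 1] then xs ! 0 else if r = [1, 2] then xs ! 1 else xs ! 2 :: nat"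
  have "admits 3 (?sel r)" for r
    using admits_proj[of 0 3] admits_proj[of 1 3] admits_proj[of 2 3]
    by (cases "r = [0, 1]"; cases "r = [1, 2]") simp_all
  then have "admits 3 (\<lambda>xs. f (map (\<lambda>g. g xs) (map ?sel rs)))"
    by (intro admits_compose[OF admits_mem[OF f]]) (use rs in auto)
  then have g: "ternary g" unfolding ternary_def g_def by (simp add: o_def)
  have cols: "map (\<lambda>t. t ! 0) rs = map (\<lambda>r. if r = [0, 1] then 0 else if r = [1, 2] then 1 else 2) rs"
    "map (\<lambda>t. t ! 1) rs = map (\<lambda>r. if r = [0, 1] then 1 else if r = [1, 2] then 2 else 0) rs"
    using rs(2) unfolding phi_def by auto
  have "map (\<lambda>j. f (map (\<lambda>t. t ! j) rs)) [0..<2] = [f (map (\<lambda>t. t ! 0) rs), f (map (\<lambda>t. t ! 1) rs)]"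
    by (simp add: upt_rec)
  also have "\<dots> = [g 0 1 2, g 1 2 0]" unfolding g_def cols ..
  finally have "[g 0 1 2, g 1 2 0] \<notin> phi" using nphi by simp
  moreover have "g 0 1 2 \<in> A" by (rule ternary_closed[OF g]) (simp_all add: three_def)
  ultimately have "g 1 2 0 \<noteq> (g 0 1 2 + 1) mod 3" unfolding phi_def three_def by auto
  with g show ?thesis by (rule that)
qed

end

section \<open>The separating relation as an affine equation modulo 2\<close>

context clone_with_sym_minority
begin

text \<open>The class modulo 2 of an element of a coordinate with the two distinguished values \<^term>\<open>t\<close> (class 0)
  and \<^term>\<open>a\<close> (class 1). If one of them is \<^term>\<open>c\<close>, then only equality with \<^term>\<open>c\<close> matters. Otherwise \<^term>\<open>c\<close>
  is wild: it can occur in the relation only at all three coordinates simultaneously.\<close>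

definition bit :: "nat \<Rightarrow> nat \<Rightarrow> nat \<Rightarrow> bool" where
  "bit t a x \<longleftrightarrow> \<not> (x = t \<or> a = c \<and> x \<noteq> c)"

definition wild :: "nat \<Rightarrow> nat \<Rightarrow> nat \<Rightarrow> bool" where
  "wild t a x \<longleftrightarrow> x = c \<and> t \<noteq> c \<and> a \<noteq> c"

lemma bit_simps: "\<not> bit t a t" "t \<noteq> a \<Longrightarrow> bit t a a" "wild t a x \<Longrightarrow> bit t a x"
  unfolding bit_def wild_def by auto

text \<open>For a tuple of even parity, one of these terms produces the forbidden tuple \<open>(t1, t2, t3)\<close> from its
  three modifications and the given tuple.\<close>

definition repair :: "nat \<Rightarrow> nat \<Rightarrow> nat \<Rightarrow> nat \<Rightarrow> nat \<Rightarrow> nat" where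
  "repair k x y z v =
    (if k = 0 then s x y (s x z v)
     else if k = 1 then s x y (s y z v)
     else if k = 2 then s x z (s y z v)
     else if k = 3 then s x y (s x z (s y z v))
     else if k = 4 then s x y (s x v (s x y v))
     else if k = 5 then s x y (s y v (s x y v))
     else if k = 6 then s x y (s x v (s y z v))
     else s x z (s x v (s x z v)))"

text \<open>Terms 0 to 3 serve tuples without wild entries, one for each even pattern of bits; terms
  4 to 7 serve tuples wild at some but not all coordinates.\<close>

lemma repair_1:
  assumes "t \<in> A" "a \<in> A" "v \<in> A" "t \<noteq> a"
  shows "wild t a v \<Longrightarrow> k \<in> {4, 7} \<Longrightarrow> repair k a t t v = t"
    "\<not> wild t a v \<Longrightarrow> k \<in> {5, 6} \<Longrightarrow> repair k a t t v = t"
    "\<not> wild t a v \<Longrightarrow> \<not> bit t a v \<Longrightarrow> k \<in> {0, 3} \<Longrightarrow> repair k a t t v = t"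
    "\<not> wild t a v \<Longrightarrow> bit t a v \<Longrightarrow> k \<in> {1, 2} \<Longrightarrow> repair k a t t v = t"
  using assms unfolding A_eq wild_def bit_def
  by (elim insertE emptyE; simp add: repair_def sym_minority_def pqc)+

lemma repair_2:
  assumes "t \<in> A" "a \<in> A" "v \<in> A" "t \<noteq> a"
  shows "wild t a v \<Longrightarrow> k \<in> {5, 7} \<Longrightarrow> repair k t a t v = t"
    "\<not> wild t a v \<Longrightarrow> k \<in> {4, 6, 7} \<Longrightarrow> repair k t a t v = t"
    "\<not> wild t a v \<Longrightarrow> \<not> bit t a v \<Longrightarrow> k \<in> {1, 3} \<Longrightarrow> repair k t a t v = t"
    "\<not> wild t a v \<Longrightarrow> bit t a v \<Longrightarrow> k \<in> {0, 2} \<Longrightarrow> repair k t a t v = t"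
  using assms unfolding A_eq wild_def bit_def
  by (elim insertE emptyE; simp add: repair_def sym_minority_def pqc)+

lemma repair_3:
  assumes "t \<in> A" "a \<in> A" "v \<in> A" "t \<noteq> a"
  shows "wild t a v \<Longrightarrow> k \<in> {4, 5, 6} \<Longrightarrow> repair k t t a v = t"
    "\<not> wild t a v \<Longrightarrow> k \<in> {4, 5, 7} \<Longrightarrow> repair k t t a v = t"
    "\<not> wild t a v \<Longrightarrow> \<not> bit t a v \<Longrightarrow> k \<in> {2, 3} \<Longrightarrow> repair k t t a v = t"
    "\<not> wild t a v \<Longrightarrow> bit t a v \<Longrightarrow> k \<in> {0, 1} \<Longrightarrow> repair k t t a v = t"
  using assms unfolding A_eq wild_def bit_def
  by (elim insertE emptyE; simp add: repair_def sym_minority_def pqc)+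

definition to_Z2 :: "nat \<Rightarrow> nat \<Rightarrow> nat \<Rightarrow> (nat list \<Rightarrow> nat) \<Rightarrow> nat list \<Rightarrow> nat" where
  "to_Z2 t a n f = restrict (\<lambda>bs. of_bool (bit t a (f (map (\<lambda>b. if b = 0 then t else a) bs)))) (tuples {0, 1} n)"

lemma minion_hom_to_Z2:
  assumes t: "t \<in> A" and a: "a \<in> A" and mem: "\<And>n f. (n, f) \<in> C \<Longrightarrow> (n, to_Z2 t a n f) \<in> Z2"
  shows "minion_hom A C {0, 1} Z2 (to_Z2 t a)"
  unfolding minion_hom_def
proof (intro conjI ballI; clarify)
  fix n f assume "(n, f) \<in> C"
  then show "(n, to_Z2 t a n f) \<in> Z2" by (rule mem)
next
  fix n r :: nat and f \<sigma> assume f: "(n, f) \<in> C" and r: "1 \<le> r" and \<sigma>: "\<forall>i<n. \<sigma> i < r"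
  show "to_Z2 t a r (minor A n r \<sigma> f) = minor {0, 1} n r \<sigma> (to_Z2 t a n f)"
  proof
    fix xs
    show "to_Z2 t a r (minor A n r \<sigma> f) xs = minor {0, 1} n r \<sigma> (to_Z2 t a n f) xs"
    proof (cases "xs \<in> tuples {0, 1} r")
      case True
      let ?e = "\<lambda>b :: nat. if b = 0 then t else a"
      have 1: "map (\<lambda>i. xs ! \<sigma> i) [0..<n] \<in> tuples {0, 1} n"
        using tuples_nth[OF True] \<sigma> by (intro tuplesI) simp_all
      have 2: "map ?e xs \<in> tuples A r" using True t a unfolding tuples_def by auto
      have 3: "map (\<lambda>i. map ?e xs ! \<sigma> i) [0..<n] = map ?e (map (\<lambda>i. xs ! \<sigma> i) [0..<n])"
        using True \<sigma> unfolding tuples_def by simp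
      show ?thesis unfolding to_Z2_def minor_def restrict_apply'[OF True] restrict_apply'[OF 1] restrict_apply'[OF 2] 3 ..
    qed (simp add: to_Z2_def minor_def)
  qed
qed

lemma minion_hom_to_Z2_exists:
  assumes "\<not> has_majority A C"
  shows "\<exists>\<xi>. minion_hom A C {0, 1} Z2 \<xi>"
proof (rule no_majority_relation[OF assms])
  fix R t1 t2 t3 a1 a2 a3
  assume RA: "R \<subseteq> A \<times> A \<times> A"
    and P1: "(a1, t2, t3) \<in> R" and P2: "(t1, a2, t3) \<in> R" and P3: "(t1, t2, a3) \<in> R"
    and tR: "(t1, t2, t3) \<notin> R"
    and inv: "\<And>n f u v w. admits n f \<Longrightarrow> length u = n \<Longrightarrow> length v = n \<Longrightarrow> length w = n \<Longrightarrow>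
       (\<And>i. i < n \<Longrightarrow> (u ! i, v ! i, w ! i) \<in> R) \<Longrightarrow> (f u, f v, f w) \<in> R"
  have tA: "t1 \<in> A" "t2 \<in> A" "t3 \<in> A" "a1 \<in> A" "a2 \<in> A" "a3 \<in> A" using RA P1 P2 P3 by blast+
  have ta: "t1 \<noteq> a1" "t2 \<noteq> a2" "t3 \<noteq> a3" using P1 P2 P3 tR by blast+
  have sR: "(s x1 y1 z1, s x2 y2 z2, s x3 y3 z3) \<in> R"
    if "(x1, x2, x3) \<in> R" "(y1, y2, y3) \<in> R" "(z1, z2, z3) \<in> R" for x1 x2 x3 y1 y2 y3 z1 z2 z3
  proof -
    let ?s = "\<lambda>xs. s (xs ! 0) (xs ! 1) (xs ! 2)"
    have "(?s [x1, y1, z1], ?s [x2, y2, z2], ?s [x3, y3, z3]) \<in> R"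
      by (rule inv[OF sym[unfolded ternary_def]])
        (use that in \<open>auto simp: less_Suc_eq numeral_3_eq_3\<close>)
    then show ?thesis by simp
  qed
  \<comment> \<open>With this, \<open>R\<close> contains every tuple of \<open>t\<close> and
    \<open>a\<close> entries with an odd number of \<open>a\<close>.\<close>
  have P4: "(a1, a2, a3) \<in> R" using sR[OF P1 P2 P3] ta unfolding sym_minority_def by simp
  have repair: "(repair k a1 t1 t1 v1, repair k t2 a2 t2 v2, repair k t3 t3 a3 v3) \<in> R"
    if v: "(v1, v2, v3) \<in> R" for k v1 v2 v3
    unfolding repair_def by (simp add: sR P1 P2 P3 v)
  have odd: "bit t1 a1 v1 = (bit t2 a2 v2 = bit t3 a3 v3)" if v: "(v1, v2, v3) \<in> R" for v1 v2 v3
  proof (rule ccontr)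
    assume even: "\<not> ?thesis"
    have vA: "v1 \<in> A" "v2 \<in> A" "v3 \<in> A" using v RA by blast+
    note r1 = repair_1[OF tA(1,4) vA(1) ta(1)]
    note r2 = repair_2[OF tA(2,5) vA(2) ta(2)]
    note r3 = repair_3[OF tA(3,6) vA(3) ta(3)]
    have "\<exists>k. repair k a1 t1 t1 v1 = t1 \<and> repair k t2 a2 t2 v2 = t2 \<and> repair k t3 t3 a3 v3 = t3"
    proof (cases "wild t1 a1 v1 \<or> wild t2 a2 v2 \<or> wild t3 a3 v3")
      case True
      \<comment> \<open>All three coordinates cannot be wild: their bits would be 1, an odd
        number.\<close>
      then consider "wild t1 a1 v1" "\<not> wild t2 a2 v2" | "\<not> wild t1 a1 v1" "wild t2 a2 v2"
        | "\<not> wild t1 a1 v1" "\<not> wild t2 a2 v2" "wild t3 a3 v3"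
        | "wild t1 a1 v1" "wild t2 a2 v2" "\<not> wild t3 a3 v3"
        using even bit_simps(3) by blast
      then show ?thesis
      proof cases
        case 1
        then show ?thesis using r1(1)[of 4] r2(2)[of 4] r3(1,2)[of 4] by blast
      next
        case 2
        then show ?thesis using r1(2)[of 5] r2(1)[of 5] r3(1,2)[of 5] by blast
      next
        case 3
        then show ?thesis using r1(2)[of 6] r2(2)[of 6] r3(1)[of 6] by blast
      next
        case 4
        then show ?thesis using r1(1)[of 7] r2(1)[of 7] r3(2)[of 7] by blast
      qed
    next
      case False
      from even consider "\<not> bit t1 a1 v1" "\<not> bit t2 a2 v2" "\<not> bit t3 a3 v3"
        | "\<not> bit t1 a1 v1" "bit t2 a2 v2" "bit t3 a3 v3"
        | "bit t1 a1 v1" "\<not> bit t2 a2 v2" "bit t3 a3 v3"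
        | "bit t1 a1 v1" "bit t2 a2 v2" "\<not> bit t3 a3 v3"
        by blast
      then show ?thesis
      proof cases
        case 1
        then show ?thesis using False r1(3)[of 3] r2(3)[of 3] r3(3)[of 3] by blast
      next
        case 2
        then show ?thesis using False r1(3)[of 0] r2(4)[of 0] r3(4)[of 0] by blast
      next
        case 3
        then show ?thesis using False r1(4)[of 1] r2(3)[of 1] r3(4)[of 1] by blast
      next
        case 4
        then show ?thesis using False r1(4)[of 2] r2(4)[of 2] r3(3)[of 2] by blast
      qed
    qed
    then show False using repair[OF v] tR by metis
  qed
  have "(n, to_Z2 t1 a1 n f) \<in> Z2" if f: "(n, f) \<in> C" for n f
  proof -
    have n: "1 \<le> n" using mem_ops[OF f] by blast
    note af = admits_mem[OF f]
    define h where "h t a bs = bit t a (f (map (\<lambda>b. if b = 0 then t else a) bs))" for t a and bs :: "nat list"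
    have h_odd: "h t1 a1 x = (h t2 a2 y = h t3 a3 z)"
      if t: "x \<in> tuples {0, 1} n" "y \<in> tuples {0, 1} n" "z \<in> tuples {0, 1} n"
        and o: "\<And>i. i < n \<Longrightarrow> odd (x ! i + y ! i + z ! i)" for x y z
      unfolding h_def
    proof (rule odd, rule inv[OF af])
      fix i assume i: "i < n"
      have "x ! i \<in> {0, 1}" "y ! i \<in> {0, 1}" "z ! i \<in> {0, 1}" using t i tuples_nth by blast+
      then show "(map (\<lambda>b. if b = 0 then t1 else a1) x ! i, map (\<lambda>b. if b = 0 then t2 else a2) y ! i,
          map (\<lambda>b. if b = 0 then t3 else a3) z ! i) \<in> R"
        using o[OF i] i t P1 P2 P3 P4 unfolding tuples_def by auto
    qed (use t in \<open>simp_all add: tuples_def\<close>)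
    have h0: "\<not> h t a (replicate n 0)" and h1: "t \<noteq> a \<Longrightarrow> h t a (replicate n 1)" if "t \<in> A" "a \<in> A" for t a
      using admits_idempotent[OF af that(1)] admits_idempotent[OF af that(2)] bit_simps(1,2)
      unfolding h_def by simp_all
    define neg where "neg x = map (\<lambda>b. 1 - b) x" for x :: "nat list"
    define xor where "xor x y = map (\<lambda>i. (x ! i + y ! i) mod 2) [0..<n]" for x y :: "nat list"
    have neg: "neg x \<in> tuples {0, 1} n" if "x \<in> tuples {0, 1} n" for x
      using that unfolding neg_def tuples_def by auto
    have xor: "xor x y \<in> tuples {0, 1} n" for x y unfolding xor_def tuples_def by auto
    have zero: "replicate n 0 \<in> tuples {0, 1} n" unfolding tuples_def by auto
    have neg_nth: "neg x ! i = 1 - x ! i" if "x \<in> tuples {0, 1} n" "i < n" for x i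
      using that unfolding neg_def tuples_def by simp
    have odd_neg: "odd (b + (1 - b))" if "b \<in> {0, 1}" for b :: nat using that by auto
    \<comment> \<open>Complementing the third tuple makes column sums odd. Padding with zeros
      relates the three functions; then \<open>h_odd\<close> at \<open>x\<close>, \<open>y\<close>,
      \<open>neg (xor x y)\<close> shows that \<open>h t1 a1\<close> is additive.\<close>
    have h3: "h t3 a3 (neg x) = (\<not> h t1 a1 x)" if x: "x \<in> tuples {0, 1} n" for x
      using h_odd[OF x zero neg[OF x]] h0[OF tA(2,5)] odd_neg tuples_nth[OF x] neg_nth[OF x] by simp
    have h2: "h t2 a2 x = h t1 a1 x" if x: "x \<in> tuples {0, 1} n" for x
      using h_odd[OF zero x neg[OF x]] h0[OF tA(1,4)] odd_neg tuples_nth[OF x] neg_nth[OF x] h3[OF x] by simp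
    have h_xor: "h t1 a1 (xor x y) = (h t1 a1 x \<noteq> h t1 a1 y)"
      if x: "x \<in> tuples {0, 1} n" and y: "y \<in> tuples {0, 1} n" for x y
    proof -
      have "odd (x ! i + y ! i + neg (xor x y) ! i)" if "i < n" for i
        using that neg_nth[OF xor that] unfolding xor_def by (simp add: odd_iff_mod_2_eq_one)
      then show ?thesis using h_odd[OF x y neg[OF xor]] h3[OF xor] h2[OF y] by blast
    qed
    show ?thesis unfolding Z2_iff
    proof (intro conjI allI impI n; (elim conjE)?)
      show "to_Z2 t1 a1 n f \<in> ops {0, 1} n" unfolding to_Z2_def ops_def by auto
      show "to_Z2 t1 a1 n f (replicate n 0) = 0" using zero h0[OF tA(1,4)] unfolding to_Z2_def h_def by simp
      have "replicate n 1 \<in> tuples {0, 1} n" unfolding tuples_def by auto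
      then show "to_Z2 t1 a1 n f (replicate n 1) = 1" using h1[OF tA(1,4) ta(1)] unfolding to_Z2_def h_def by simp
      fix x y z w assume tt: "{x, y, z, w} \<subseteq> tuples {0, 1} n"
        and e: "\<forall>i<n. even (x ! i + y ! i + z ! i + w ! i)"
      have "(x ! i + y ! i) mod 2 = (z ! i + w ! i) mod 2" if "i < n" for i
        using e that by (metis add.assoc even_add parity_cases even_iff_mod_2_eq_zero odd_iff_mod_2_eq_one)
      then have "xor x y = xor z w" unfolding xor_def by simp
      then have "(h t1 a1 x \<noteq> h t1 a1 y) = (h t1 a1 z \<noteq> h t1 a1 w)" using h_xor tt by (metis insert_subset)
      moreover have "to_Z2 t1 a1 n f u = of_bool (h t1 a1 u)" if "u \<in> {x, y, z, w}" for u
        using that tt unfolding to_Z2_def h_def by auto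
      ultimately show "even (to_Z2 t1 a1 n f x + to_Z2 t1 a1 n f y + to_Z2 t1 a1 n f z + to_Z2 t1 a1 n f w)"
        by auto
    qed
  qed
  then show ?thesis using minion_hom_to_Z2[OF tA(1,4)] by blast
qed

end

section \<open>The minion equivalence\<close>

theorem theorem7p4:
  fixes C :: "(nat \<times> (nat list \<Rightarrow> nat)) set"
  assumes "is_clone {0, 1, 2} C"
    and "idempotent_clone {0, 1, 2} C"
    and "malcev_clone {0, 1, 2} C"
    and "\<not> has_majority {0, 1, 2} C"
    and "\<not> clone_preserves C 2 phi"
  shows "minion_equiv {0, 1, 2} C {0, 1} Z2"
proof -
  note assms' = assms(1-4)[folded three_def]
  interpret idempotent_clone_on_three C
    by unfold_locales (fact assms'(1), fact assms'(2))
  obtain d where d: "(3, d) \<in> C" "\<forall>x\<in>A. \<forall>y\<in>A. d [y, x, x] = y \<and> d [x, x, y] = y"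
    using assms'(3) unfolding malcev_clone_def by blast
  have "ternary (\<lambda>x y z. d [x, y, z])"
    unfolding ternary_def using admits_mem[OF d(1)] by (rule admits_cong) (auto simp: tuples_3)
  with d(2) have malcev: "malcev_op (\<lambda>x y z. d [x, y, z])" unfolding malcev_op_def by blast
  obtain g where g: "ternary g" "g 1 2 0 \<noteq> (g 0 1 2 + 1) mod 3"
    using not_shift_invariant_op[OF assms(5)] by blast
  obtain m where "is_minority m" using minority_exists[OF malcev g] by blast
  then obtain c where c: "c \<in> A" "ternary (sym_minority c)" using sym_minority_exists g by blast
  obtain p q where pq: "A = {p, q, c}" "distinct [p, q, c]"
  proof -
    from c(1) consider "c = 0" | "c = 1" | "c = 2" unfolding three_def by auto
    then show ?thesis
      by cases (rule that[of 1 2] that[of 0 2] that[of 0 1]; auto simp: three_def)+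
  qed
  interpret clone_with_sym_minority C p q c
    by unfold_locales (fact pq c(2))+
  show ?thesis
    using minion_hom_to_Z2_exists[OF assms'(4)] minion_hom_from_Z2
    unfolding minion_equiv_def three_def by blast
qed

end
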